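(* Let $a,b,c$ be positive numbers with $a<b<c$ and $b-a<c_0<a$, where $c_0=c-\lfloor c/b\rfloor b$. Set $c_1=\lfloor c/b\rfloor b-\lfloor \lfloor c/b\rfloor b/a\rfloor a$. Suppose $\lfloor c/b\rfloor\ge2$. (IX) If $c_1>2a-b$, then $\mathcal G(\chi_{[0,c)},a\mathbb Z\times\mathbb Z/b)$ is a Gabor frame. (X) If $c_1=2a-b$, then $\mathcal G(\chi_{[0,c)},a\mathbb Z\times\mathbb Z/b)$ is a Gabor frame if and only if $a/b=p/q$ for some coprime positive integers $p,q$ with $c_0\le b-a+b/q$ and $\lfloor c/b\rfloor+1=p$. (XI) If $c_1=0$, then $\mathcal G(\chi_{[0,c)},a\mathbb Z\times\mathbb Z/b)$ is a Gabor frame if and only if $a/b=p/q$ for some coprime positive integers $p,q$ with $c_0\ge a-b/q$ and $\lfloor c/b\rfloor=p$.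
   Context: For $\phi\in L^2(\mathbb R)$ and $a,b>0$, the Gabor system is $\mathcal G(\phi,a\mathbb Z\times\mathbb Z/b)=\{e^{-2\pi i n t/b}\phi(t-ma): (m,n)\in\mathbb Z\times\mathbb Z\}$. It is called a Gabor frame if it is a frame for $L^2(\mathbb R)$: there are constants $0<A\le B<\infty$ such that $A\|f\|_2^2\le\sum_{\psi\in\mathcal G}|\langle f,\psi\rangle|^2\le B\|f\|_2^2$ for all $f\in L^2(\mathbb R)$. $\chi_E$ is the indicator function of $E$ and $\lfloor x\rfloor$ is the integer part of $x$. *)

theory Defs
  imports "HOL-Analysis.Analysis"
begin

text \<open>Elements of L^2(R) are represented by measurable complex-valued functions on the
  reals whose squared modulus is Lebesgue integrable.\<close>
definition square_integrable :: "(real \<Rightarrow> complex) \<Rightarrow> bool" where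
  "square_integrable f \<longleftrightarrow> f \<in> borel_measurable lborel \<and> integrable lborel (\<lambda>t. (norm (f t))\<^sup>2)"

definition l2_inner :: "(real \<Rightarrow> complex) \<Rightarrow> (real \<Rightarrow> complex) \<Rightarrow> complex" where
  "l2_inner f g = (LINT t|lborel. f t * cnj (g t))"

definition l2_norm_sq :: "(real \<Rightarrow> complex) \<Rightarrow> real" where
  "l2_norm_sq f = (LINT t|lborel. (norm (f t))\<^sup>2)"

definition gabor_atom :: "(real \<Rightarrow> complex) \<Rightarrow> real \<Rightarrow> real \<Rightarrow> int \<Rightarrow> int \<Rightarrow> real \<Rightarrow> complex" where
  "gabor_atom \<phi> a b m n t = exp (- 2 * pi * \<i> * of_int n * of_real t / of_real b) * \<phi> (t - of_int m * a)"

definition gabor_frame :: "(real \<Rightarrow> complex) \<Rightarrow> real \<Rightarrow> real \<Rightarrow> bool" where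
  "gabor_frame \<phi> a b \<longleftrightarrow>
     (\<exists>A B. 0 < A \<and> A \<le> B \<and>
        (\<forall>f. square_integrable f \<longrightarrow>
           (\<lambda>(m, n). (norm (l2_inner f (gabor_atom \<phi> a b m n)))\<^sup>2) summable_on (UNIV :: (int \<times> int) set) \<and>
           A * l2_norm_sq f \<le> (\<Sum>\<^sub>\<infinity>(m, n)\<in>(UNIV :: (int \<times> int) set). (norm (l2_inner f (gabor_atom \<phi> a b m n)))\<^sup>2) \<and>
           (\<Sum>\<^sub>\<infinity>(m, n)\<in>(UNIV :: (int \<times> int) set). (norm (l2_inner f (gabor_atom \<phi> a b m n)))\<^sup>2) \<le> B * l2_norm_sq f))"

end

theory Submission
  imports Defs
begin

text \<open>
  Put \<open>d = \<lfloor>c / b\<rfloor>\<close>. By Parseval on \<open>[0, b)\<close>, the frame inequality for \<open>f\<close> is an integral over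
  \<open>t \<in> [0, b)\<close> of inequalities for the sequences \<open>z k = f (t + k b)\<close>: their \<open>\<ell>\<^sup>2\<close> norm has to be
  controlled by that of the sums \<open>W m\<close> of \<open>z\<close> over the points \<open>t + k b\<close> in the windows
  \<open>[m a, m a + c)\<close>. Subtracting consecutive window sums shows that, up to the differences
  \<open>W m - W (m + 1)\<close>, the sequence \<open>z\<close> is constant along the partial map sending a point with residue
  \<open>r\<close> modulo \<open>a\<close> to the point \<open>(d + 1) b\<close> further if \<open>r < c0 + a - b\<close>, and \<open>d b\<close> further if
  \<open>c0 \<le> r\<close>, and that \<open>z\<close> vanishes on the hole \<open>c0 + a - b \<le> r < c0\<close>.

  If \<open>c1 > 2 a - b\<close>, residues on both sides of the hole are moved towards it and fall into it after
  boundedly many steps, so \<open>z\<close> is controlled by \<open>W\<close>. If \<open>c1 = 2 a - b\<close> (resp. \<open>c1 = 0\<close>), the residues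
  left (resp. right) of the hole are fixed, and the others still fall into the hole. Every window
  meets each of the resulting periodic orbits exactly once. If there is only one such orbit, its
  values are recovered from the window sums; if there are two for an interval of base points \<open>t\<close>,
  then \<open>1\<close> on the first and \<open>-1\<close> on the second, truncated, violates the lower frame bound.
  Counting the points of \<open>t + b \<int>\<close> with residue in the fixed interval gives the condition on \<open>p\<close>, \<open>q\<close>.
\<close>

section \<open>Parseval's identity for Fourier series\<close>

text \<open>The exponent has the sign opposite to that in \<open>gabor_atom\<close>: the inner
  product conjugates the atom, so Gabor coefficients become integrals against
  \<open>fmode\<close>.\<close>

definition fmode :: "real \<Rightarrow> int \<Rightarrow> real \<Rightarrow> complex" where
  "fmode b k t = cis (2 * pi * of_int k * t / b)"

lemma fmode_mult: "fmode b j t * fmode b k t = fmode b (j + k) t"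
  by (simp add: fmode_def cis_mult field_simps add_divide_distrib)

lemma cnj_fmode: "cnj (fmode b k t) = fmode b (- k) t"
  by (simp add: fmode_def cis_cnj)

lemma norm_fmode [simp]: "norm (fmode b k t) = 1"
  by (simp add: fmode_def)

lemma fmode_0 [simp]: "fmode b 0 t = 1"
  by (simp add: fmode_def)

lemma measurable_fmode [measurable]: "fmode b k \<in> borel_measurable borel"
proof -
  have "continuous_on UNIV (fmode b k)"
    unfolding fmode_def cis_conv_exp divide_inverse by (intro continuous_intros)
  then show ?thesis by (rule borel_measurable_continuous_onI)
qed

lemma fmode_shift:
  assumes "b \<noteq> 0"
  shows "fmode b k (t + of_int j * b) = fmode b k t"
proof -
  have "2 * pi * of_int k * (t + of_int j * b) / b = 2 * pi * of_int k * t / b + 2 * pi * of_int (k * j)"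
    using assms by (simp add: field_simps)
  then show ?thesis
    by (simp add: fmode_def flip: cis_mult)
qed

text \<open>Half-open, so that the translates by integer multiples of \<open>b\<close> tile the line
  without overlap.\<close>

abbreviation period :: "real \<Rightarrow> real measure" where
  "period b \<equiv> restrict_space lborel {0..<b}"

lemma space_period [simp]: "space (period b) = {0..<b}"
  by (simp add: space_restrict_space)

lemma measurable_period: "f \<in> borel_measurable borel \<Longrightarrow> f \<in> borel_measurable (period b)"
  by (rule measurable_restrict_space1) simp

lemma finite_measure_period: "finite_measure (period b)"
  by (cases "0 \<le> b"; rule finite_measureI) (simp_all add: emeasure_restrict_space)

lemma integral_fmode:
  assumes "0 < b"
  shows "(LINT t|period b. fmode b k t) = (if k = 0 then of_real b else 0)"
proof (cases "k = 0")
  case True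
  then show ?thesis using assms
    by (simp add: measure_restrict_space scaleR_conv_of_real)
next
  case False
  define w where "w = 2 * pi * of_int k / b"
  have w: "w \<noteq> 0" using False assms by (simp add: w_def)
  have fm: "fmode b k t = exp (\<i> * of_real (w * t))" for t
    by (simp add: fmode_def cis_conv_exp w_def)
  have "(LINT t|period b. fmode b k t) = (LINT t:{0..<b}|lborel. fmode b k t)"
    by (simp add: integral_restrict_space set_lebesgue_integral_def)
  \<comment> \<open>The endpoint \<open>b\<close> is a null set; on the closed interval the
    fundamental theorem of calculus applies, with primitive
    \<open>exp (i w t) / (i w)\<close>.\<close>
  also have "\<dots> = (LINT t:{0..b}|lborel. fmode b k t)"
    unfolding set_lebesgue_integral_def
  proof (rule integral_cong_AE)
    show "AE x in lborel. indicat_real {0..<b} x *\<^sub>R fmode b k x = indicat_real {0..b} x *\<^sub>R fmode b k x"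
      using AE_lborel_singleton[of b] by eventually_elim (auto simp: indicator_def)
  qed measurable
  also have "\<dots> = (LINT t|lborel. indicator {0..b} t *\<^sub>R fmode b k t)"
    by (simp add: set_lebesgue_integral_def)
  also have "\<dots> = exp (\<i> * of_real (w * b)) / (\<i> * of_real w) - exp (\<i> * of_real (w * 0)) / (\<i> * of_real w)"
  proof (rule integral_FTC_Icc)
    show "0 \<le> b" using assms by simp
    fix x :: real
    have "((\<lambda>z. exp (\<i> * (of_real w * z)) / (\<i> * of_real w)) has_field_derivative exp (\<i> * (of_real w * of_real x))) (at (of_real x))"
      using w by (auto intro!: derivative_eq_intros simp: field_simps)
    from has_vector_derivative_real_field[OF this]
    show "((\<lambda>a. exp (\<i> * of_real (w * a)) / (\<i> * of_real w)) has_vector_derivative fmode b k x) (at x within {0..b})"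
      by (simp add: fm has_vector_derivative_at_within)
  next
    show "continuous_on {0..b} (fmode b k)"
      unfolding fm by (intro continuous_intros)
  qed
  also have "exp (\<i> * of_real (w * b)) = 1"
  proof -
    have "w * b = 2 * pi * of_int k" using assms by (simp add: w_def)
    then show ?thesis by (metis cis_conv_exp cis_multiple_2pi Ints_of_int)
  qed
  finally show ?thesis using False by simp
qed

section \<open>Trigonometric polynomials and their density in L2 of a period\<close>

definition trig :: "real \<Rightarrow> (real \<Rightarrow> complex) set" where
  "trig b = {T. \<exists>S \<alpha>. finite S \<and> T = (\<lambda>t. \<Sum>k\<in>S. \<alpha> k * fmode b k t)}"

lemma trig_fmode: "(\<lambda>t. z * fmode b k t) \<in> trig b"
  unfolding trig_def by (auto intro!: exI[of _ "{k}"] exI[of _ "\<lambda>_. z"])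

lemma trig_add:
  assumes "f \<in> trig b" "g \<in> trig b"
  shows "(\<lambda>t. f t + g t) \<in> trig b"
proof -
  obtain S \<alpha> S' \<alpha>' where S: "finite S" "f = (\<lambda>t. \<Sum>k\<in>S. \<alpha> k * fmode b k t)"
    and S': "finite S'" "g = (\<lambda>t. \<Sum>k\<in>S'. \<alpha>' k * fmode b k t)"
    using assms unfolding trig_def by blast
  \<comment> \<open>Both coefficient families are extended by zero to the union of the supports, so
    that one index set serves for the sum.\<close>
  let ?\<gamma> = "\<lambda>k. (if k \<in> S then \<alpha> k else 0) + (if k \<in> S' then \<alpha>' k else 0)"
  have "f t + g t = (\<Sum>k\<in>S \<union> S'. ?\<gamma> k * fmode b k t)" for t
  proof -
    have "f t = (\<Sum>k\<in>S \<union> S'. (if k \<in> S then \<alpha> k else 0) * fmode b k t)"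
      unfolding S(2) using S(1) S'(1) by (intro sum.mono_neutral_cong_left) auto
    moreover have "g t = (\<Sum>k\<in>S \<union> S'. (if k \<in> S' then \<alpha>' k else 0) * fmode b k t)"
      unfolding S'(2) using S(1) S'(1) by (intro sum.mono_neutral_cong_left) auto
    ultimately show ?thesis by (simp add: distrib_right sum.distrib)
  qed
  then show ?thesis unfolding trig_def using S(1) S'(1)
    by (auto intro!: exI[of _ "S \<union> S'"] exI[of _ ?\<gamma>])
qed

lemma trig_0: "(\<lambda>t. 0) \<in> trig b"
  unfolding trig_def by (auto intro!: exI[of _ "{}"])

lemma trig_sum: "(\<And>i. i \<in> I \<Longrightarrow> f i \<in> trig b) \<Longrightarrow> (\<lambda>t. \<Sum>i\<in>I. f i t) \<in> trig b"
  by (induction I rule: infinite_finite_induct) (auto simp: trig_0 intro: trig_add)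

lemma trig_mult:
  assumes "f \<in> trig b" "g \<in> trig b"
  shows "(\<lambda>t. f t * g t) \<in> trig b"
proof -
  obtain S \<alpha> S' \<alpha>' where S: "finite S" "f = (\<lambda>t. \<Sum>k\<in>S. \<alpha> k * fmode b k t)"
    and S': "finite S'" "g = (\<lambda>t. \<Sum>k\<in>S'. \<alpha>' k * fmode b k t)"
    using assms unfolding trig_def by blast
  have "f t * g t = (\<Sum>k\<in>S. \<Sum>j\<in>S'. (\<alpha> k * \<alpha>' j) * fmode b (k + j) t)" for t
    unfolding S S' sum_product by (simp add: fmode_mult[symmetric] mult_ac)
  then show ?thesis by (simp add: trig_sum trig_fmode)
qed

lemma trig_const: "(\<lambda>t. z) \<in> trig b"
  using trig_fmode[of z b 0] by simp

lemma trig_measurable: "T \<in> trig b \<Longrightarrow> T \<in> borel_measurable borel"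
  unfolding trig_def by auto

text \<open>Induction on polynomial functions of the plane. The base case is a real-linear
  functional, hence a combination of real and imaginary part; on the unit circle these are
  combinations of the modes \<open>1\<close> and \<open>-1\<close>.\<close>

lemma trig_real_polynomial:
  assumes "real_polynomial_function (p :: complex \<Rightarrow> real)"
  shows "(\<lambda>t. of_real (p (fmode b 1 t))) \<in> trig b"
  using assms
proof (induction p)
  case (linear f)
  interpret bounded_linear f by fact
  have "of_real (f (fmode b 1 t)) =
      complex_of_real (f 1) * ((1/2) * fmode b 1 t + (1/2) * fmode b (-1) t) +
      complex_of_real (f \<i>) * ((-\<i>/2) * fmode b 1 t + (\<i>/2) * fmode b (-1) t)" for t
  proof -
    let ?z = "fmode b 1 t"
    have "f ?z = f (Re ?z *\<^sub>R 1 + Im ?z *\<^sub>R \<i>)"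
      by (rule arg_cong[of _ _ f]) (simp add: complex_eq_iff)
    also have "\<dots> = Re ?z * f 1 + Im ?z * f \<i>" by (simp add: add scaleR)
    finally show ?thesis
      by (simp add: cnj_fmode[symmetric] complex_eq_iff field_simps)
  qed
  moreover have "(\<lambda>t. complex_of_real (f 1) * ((1/2) * fmode b 1 t + (1/2) * fmode b (-1) t) +
      complex_of_real (f \<i>) * ((-\<i>/2) * fmode b 1 t + (\<i>/2) * fmode b (-1) t)) \<in> trig b"
    by (intro trig_add trig_mult trig_const trig_fmode)
  ultimately show ?case by simp
next
  case (const c) then show ?case by (simp add: trig_const)
next
  case (add f g) then show ?case by (simp add: trig_add)
next
  case (mult f g) then show ?case by (simp add: trig_mult)
qed

text \<open>The squared L2 distance, taken in \<open>ennreal\<close> so that it makes sense before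
  any square integrability is known.\<close>

definition sqdist :: "real \<Rightarrow> (real \<Rightarrow> complex) \<Rightarrow> (real \<Rightarrow> complex) \<Rightarrow> ennreal" where
  "sqdist b F G = (\<integral>\<^sup>+t. ennreal ((norm (F t - G t))\<^sup>2) \<partial>period b)"

lemma norm_add_sq_le: "(norm (x + y))\<^sup>2 \<le> 2 * (norm x)\<^sup>2 + 2 * (norm (y :: 'a :: real_normed_vector))\<^sup>2"
proof -
  have "(norm (x + y))\<^sup>2 \<le> (norm x + norm y)\<^sup>2"
    by (intro power_mono norm_triangle_ineq) auto
  also have "\<dots> \<le> 2 * (norm x)\<^sup>2 + 2 * (norm y)\<^sup>2"
    using sum_squares_bound[of "norm x" "norm y"] by (simp add: power2_sum)
  finally show ?thesis .
qed

text \<open>A substitute for Minkowski's inequality: the factors 2 come from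
  \<open>norm_add_sq_le\<close> and do no harm in density arguments.\<close>

lemma sqdist_add_le:
  assumes [measurable]: "F \<in> borel_measurable (period b)" "G \<in> borel_measurable (period b)"
    "F' \<in> borel_measurable (period b)" "G' \<in> borel_measurable (period b)"
  shows "sqdist b (\<lambda>t. F t + G t) (\<lambda>t. F' t + G' t) \<le> 2 * sqdist b F F' + 2 * sqdist b G G'"
proof -
  have "sqdist b (\<lambda>t. F t + G t) (\<lambda>t. F' t + G' t) \<le>
     (\<integral>\<^sup>+t. 2 * ennreal ((norm (F t - F' t))\<^sup>2) + 2 * ennreal ((norm (G t - G' t))\<^sup>2) \<partial>period b)"
    unfolding sqdist_def
  proof (rule nn_integral_mono)
    fix t
    have "(norm (F t + G t - (F' t + G' t)))\<^sup>2 \<le> 2 * (norm (F t - F' t))\<^sup>2 + 2 * (norm (G t - G' t))\<^sup>2"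
      using norm_add_sq_le[of "F t - F' t" "G t - G' t"] by (simp add: algebra_simps)
    then have "ennreal ((norm (F t + G t - (F' t + G' t)))\<^sup>2) \<le> ennreal (2 * (norm (F t - F' t))\<^sup>2 + 2 * (norm (G t - G' t))\<^sup>2)"
      by (rule ennreal_leI)
    then show "ennreal ((norm (F t + G t - (F' t + G' t)))\<^sup>2) \<le> 2 * ennreal ((norm (F t - F' t))\<^sup>2) + 2 * ennreal ((norm (G t - G' t))\<^sup>2)"
      by (simp add: ennreal_mult')
  qed
  also have "\<dots> = 2 * sqdist b F F' + 2 * sqdist b G G'"
    unfolding sqdist_def by (simp add: nn_integral_add nn_integral_cmult)
  finally show ?thesis .
qed

lemma ennreal_four_quarters: "0 < \<epsilon> \<Longrightarrow> 2 * ennreal (\<epsilon> / 4) + 2 * ennreal (\<epsilon> / 4) = ennreal \<epsilon>"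
  by (simp flip: ennreal_numeral ennreal_mult'' ennreal_plus)

text \<open>Membership in the L2 closure of the trigonometric polynomials. The tolerance bounds the
  squared distance.\<close>

definition trig_approx :: "real \<Rightarrow> (real \<Rightarrow> complex) \<Rightarrow> bool" where
  "trig_approx b F \<longleftrightarrow> F \<in> borel_measurable (period b) \<and>
     (\<forall>\<epsilon>>0. \<exists>T\<in>trig b. sqdist b F T \<le> ennreal \<epsilon>)"

lemma trig_approx_closed:
  assumes F [measurable]: "F \<in> borel_measurable (period b)"
    and "\<And>\<epsilon>. \<epsilon> > 0 \<Longrightarrow> \<exists>G. trig_approx b G \<and> sqdist b F G \<le> ennreal \<epsilon>"
  shows "trig_approx b F"
  unfolding trig_approx_def
proof (intro conjI allI impI F)
  fix \<epsilon> :: real assume \<epsilon>: "\<epsilon> > 0"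
  obtain G where G: "trig_approx b G" "sqdist b F G \<le> ennreal (\<epsilon> / 4)"
    using assms(2)[of "\<epsilon> / 4"] \<epsilon> by auto
  then obtain T where T: "T \<in> trig b" "sqdist b G T \<le> ennreal (\<epsilon> / 4)"
    using \<epsilon> unfolding trig_approx_def by (metis zero_less_divide_iff zero_less_numeral)
  have [measurable]: "G \<in> borel_measurable (period b)" using G by (simp add: trig_approx_def)
  have [measurable]: "T \<in> borel_measurable (period b)" using T(1) trig_measurable measurable_period by blast
  \<comment> \<open>Written as sums \<open>(F - G) + G\<close> and \<open>0 + T\<close>, the two
    functions fit \<open>sqdist_add_le\<close>, which then acts as a triangle inequality through
    \<open>G\<close>.\<close>
  have "sqdist b F T = sqdist b (\<lambda>t. (F t - G t) + G t) (\<lambda>t. 0 + T t)" by simp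
  also have "\<dots> \<le> 2 * sqdist b (\<lambda>t. F t - G t) (\<lambda>t. 0) + 2 * sqdist b G T"
    by (rule sqdist_add_le) auto
  also have "sqdist b (\<lambda>t. F t - G t) (\<lambda>t. 0) = sqdist b F G" by (simp add: sqdist_def)
  also have "2 * sqdist b F G + 2 * sqdist b G T \<le> 2 * ennreal (\<epsilon> / 4) + 2 * ennreal (\<epsilon> / 4)"
    using G T by (intro add_mono mult_left_mono) auto
  also have "\<dots> = ennreal \<epsilon>" using \<epsilon> by (rule ennreal_four_quarters)
  finally show "\<exists>T\<in>trig b. sqdist b F T \<le> ennreal \<epsilon>" using T by blast
qed

lemma trig_approx_add:
  assumes "trig_approx b F" "trig_approx b G"
  shows "trig_approx b (\<lambda>t. F t + G t)"
proof -
  have [measurable]: "F \<in> borel_measurable (period b)" "G \<in> borel_measurable (period b)"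
    using assms by (auto simp: trig_approx_def)
  show ?thesis unfolding trig_approx_def
  proof (intro conjI allI impI)
    fix \<epsilon> :: real assume \<epsilon>: "\<epsilon> > 0"
    obtain T where T: "T \<in> trig b" "sqdist b F T \<le> ennreal (\<epsilon> / 4)"
      using assms(1) \<epsilon> unfolding trig_approx_def by (metis zero_less_divide_iff zero_less_numeral)
    obtain U where U: "U \<in> trig b" "sqdist b G U \<le> ennreal (\<epsilon> / 4)"
      using assms(2) \<epsilon> unfolding trig_approx_def by (metis zero_less_divide_iff zero_less_numeral)
    have [measurable]: "T \<in> borel_measurable (period b)" "U \<in> borel_measurable (period b)"
      using T(1) U(1) trig_measurable measurable_period by blast+
    have "sqdist b (\<lambda>t. F t + G t) (\<lambda>t. T t + U t) \<le> 2 * sqdist b F T + 2 * sqdist b G U"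
      by (rule sqdist_add_le) auto
    also have "\<dots> \<le> 2 * ennreal (\<epsilon> / 4) + 2 * ennreal (\<epsilon> / 4)"
      using T U by (intro add_mono mult_left_mono) auto
    also have "\<dots> = ennreal \<epsilon>" using \<epsilon> by (rule ennreal_four_quarters)
    finally show "\<exists>T\<in>trig b. sqdist b (\<lambda>t. F t + G t) T \<le> ennreal \<epsilon>"
      using trig_add[OF T(1) U(1)] by blast
  qed measurable
qed

lemma sqdist_cmult:
  assumes [measurable]: "F \<in> borel_measurable (period b)" "G \<in> borel_measurable (period b)"
  shows "sqdist b (\<lambda>t. z * F t) (\<lambda>t. z * G t) = ennreal ((norm z)\<^sup>2) * sqdist b F G"
proof -
  have "norm (z * F t - z * G t) = norm z * norm (F t - G t)" for t
    by (simp add: norm_mult flip: right_diff_distrib)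
  then show ?thesis
    unfolding sqdist_def by (simp add: power_mult_distrib ennreal_mult' nn_integral_cmult)
qed

lemma trig_approx_cmult:
  assumes "trig_approx b F"
  shows "trig_approx b (\<lambda>t. z * F t)"
proof -
  have [measurable]: "F \<in> borel_measurable (period b)"
    using assms by (auto simp: trig_approx_def)
  show ?thesis unfolding trig_approx_def
  proof (intro conjI allI impI)
    fix \<epsilon> :: real assume \<epsilon>: "\<epsilon> > 0"
    let ?c = "(norm z)\<^sup>2 + 1"
    have c: "?c > 0" using zero_le_power2[of "norm z"] by linarith
    obtain T where T: "T \<in> trig b" "sqdist b F T \<le> ennreal (\<epsilon> / ?c)"
      using assms \<epsilon> c unfolding trig_approx_def by (meson divide_pos_pos)
    have [measurable]: "T \<in> borel_measurable (period b)"
      using T(1) trig_measurable measurable_period by blast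
    have "sqdist b (\<lambda>t. z * F t) (\<lambda>t. z * T t) \<le> ennreal ((norm z)\<^sup>2) * ennreal (\<epsilon> / ?c)"
      using T by (simp add: sqdist_cmult mult_left_mono)
    also have "\<dots> = ennreal ((norm z)\<^sup>2 * (\<epsilon> / ?c))" by (rule ennreal_mult'[symmetric]) simp
    also have "\<dots> \<le> ennreal \<epsilon>"
      using c \<epsilon> by (intro ennreal_leI) (simp add: field_simps)
    finally show "\<exists>T\<in>trig b. sqdist b (\<lambda>t. z * F t) T \<le> ennreal \<epsilon>"
      using trig_mult[OF trig_const T(1)] by blast
  qed measurable
qed

text \<open>Dominated convergence with majorant \<open>g\<close> squared makes the squared distances
  tend to 0, and the closure is closed.\<close>

lemma trig_approx_limit:
  assumes F [measurable]: "F \<in> borel_measurable (period b)"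
    and U: "\<And>i :: nat. trig_approx b (U i)"
    and g: "(\<integral>\<^sup>+t. ennreal ((g t)\<^sup>2) \<partial>period b) < \<infinity>" and [measurable]: "g \<in> borel_measurable (period b)"
    and le: "\<And>i t. t \<in> {0..<b} \<Longrightarrow> norm (F t - U i t) \<le> g t"
    and lim: "\<And>t. t \<in> {0..<b} \<Longrightarrow> (\<lambda>i. U i t) \<longlonglongrightarrow> F t"
  shows "trig_approx b F"
proof (rule trig_approx_closed[OF F])
  fix \<epsilon> :: real assume \<epsilon>: "\<epsilon> > 0"
  have [measurable]: "U i \<in> borel_measurable (period b)" for i
    using U by (auto simp: trig_approx_def)
  have "(\<lambda>i. sqdist b F (U i)) \<longlonglongrightarrow> (\<integral>\<^sup>+t. 0 \<partial>period b)"
    unfolding sqdist_def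
  proof (rule nn_integral_dominated_convergence[where w = "\<lambda>t. ennreal ((g t)\<^sup>2)"])
    show "AE t in period b. ennreal ((norm (F t - U i t))\<^sup>2) \<le> ennreal ((g t)\<^sup>2)" for i
      using le by (intro AE_I2 ennreal_leI power_mono) auto
    show "AE t in period b. (\<lambda>i. ennreal ((norm (F t - U i t))\<^sup>2)) \<longlonglongrightarrow> 0"
    proof (rule AE_I2)
      fix t assume "t \<in> space (period b)"
      then have "(\<lambda>i. (norm (F t - U i t))\<^sup>2) \<longlonglongrightarrow> (norm (F t - F t))\<^sup>2"
        using lim by (intro tendsto_intros) auto
      then show "(\<lambda>i. ennreal ((norm (F t - U i t))\<^sup>2)) \<longlonglongrightarrow> 0"
        using tendsto_ennrealI by fastforce
    qed
  qed (use g in measurable)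
  then have "(\<lambda>i. sqdist b F (U i)) \<longlonglongrightarrow> 0" by simp
  then have "\<forall>\<^sub>F i in sequentially. sqdist b F (U i) < ennreal \<epsilon>"
    using \<epsilon> by (intro order_tendstoD) auto
  then obtain i where "sqdist b F (U i) < ennreal \<epsilon>"
    by (auto simp: eventually_sequentially)
  then show "\<exists>G. trig_approx b G \<and> sqdist b F G \<le> ennreal \<epsilon>"
    using U by (intro exI[of _ "U i"]) auto
qed

text \<open>Stone-Weierstrass on the unit circle gives a uniformly close real polynomial, which
  becomes a trigonometric polynomial along the mode \<open>1\<close>.\<close>

lemma trig_approx_continuous:
  fixes g :: "complex \<Rightarrow> real"
  assumes g: "continuous_on UNIV g" and b: "0 < b"
  shows "trig_approx b (\<lambda>t. of_real (g (fmode b 1 t)))"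
  unfolding trig_approx_def
proof (intro conjI allI impI)
  have [measurable]: "g \<in> borel_measurable borel" using g by (rule borel_measurable_continuous_onI)
  show "(\<lambda>t. complex_of_real (g (fmode b 1 t))) \<in> borel_measurable (period b)"
    by (rule measurable_period) measurable
  fix \<epsilon> :: real assume \<epsilon>: "\<epsilon> > 0"
  \<comment> \<open>A uniform error \<eta> costs \<eta> squared times \<open>b\<close> in squared
    distance, which is exactly \<epsilon>.\<close>
  define \<eta> where "\<eta> = sqrt (\<epsilon> / b)"
  have \<eta>: "\<eta> > 0" using \<epsilon> b by (simp add: \<eta>_def)
  obtain p where p: "real_polynomial_function p" "\<And>z. z \<in> sphere 0 1 \<Longrightarrow> \<bar>g z - p z\<bar> < \<eta>"
    using Stone_Weierstrass_real_polynomial_function[of "sphere 0 1" g \<eta>]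
      continuous_on_subset[OF g] \<eta> by auto
  have "sqdist b (\<lambda>t. of_real (g (fmode b 1 t))) (\<lambda>t. of_real (p (fmode b 1 t)))
     \<le> (\<integral>\<^sup>+t. ennreal (\<eta>\<^sup>2) \<partial>period b)"
    unfolding sqdist_def
  proof (intro nn_integral_mono ennreal_leI power_mono)
    fix t
    show "norm (complex_of_real (g (fmode b 1 t)) - complex_of_real (p (fmode b 1 t))) \<le> \<eta>"
      using p(2)[of "fmode b 1 t"] by (simp flip: of_real_diff)
  qed auto
  also have "\<dots> = ennreal (\<eta>\<^sup>2) * ennreal b" using b by (simp add: emeasure_restrict_space)
  also have "\<dots> = ennreal (\<eta>\<^sup>2 * b)" using b by (simp add: ennreal_mult')
  also have "\<eta>\<^sup>2 * b = \<epsilon>" using b \<epsilon> by (simp add: \<eta>_def)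
  finally show "\<exists>T\<in>trig b. sqdist b (\<lambda>t. of_real (g (fmode b 1 t))) T \<le> ennreal \<epsilon>"
    using trig_real_polynomial[OF p(1)] by blast
qed

lemma trig_approx_cong:
  assumes F: "trig_approx b F" and eq: "\<And>t. t \<in> {0..<b} \<Longrightarrow> F t = G t"
  shows "trig_approx b G"
proof -
  have "F \<in> borel_measurable (period b) \<longleftrightarrow> G \<in> borel_measurable (period b)"
    by (rule measurable_cong) (use eq in auto)
  moreover have "sqdist b F T = sqdist b G T" for T
    unfolding sqdist_def by (rule nn_integral_cong) (use eq in auto)
  ultimately show ?thesis using F by (simp add: trig_approx_def)
qed

lemma trig_approx_const: "trig_approx b (\<lambda>t. z)"
  unfolding trig_approx_def using trig_const[of z b] by (auto simp: sqdist_def intro!: bexI[of _ "\<lambda>t. z"])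

lemma nn_integral_period_const: "(\<integral>\<^sup>+t. ennreal r \<partial>period b) < \<infinity>"
  by (cases "0 \<le> b") (auto simp: emeasure_restrict_space ennreal_mult_less_top)

text \<open>The indicator of an open set is the pointwise limit of the continuous cutoffs
  \<open>min 1 (n * infdist z (- U))\<close>, all lying between 0 and 1.\<close>

lemma trig_approx_open:
  assumes U: "open U" and b: "0 < b"
  shows "trig_approx b (\<lambda>t. indicator U (fmode b 1 t))"
\<comment> \<open>The distance to the empty set is 0 by convention, so the cutoffs would vanish
  identically when \<open>U\<close> is the whole plane.\<close>
proof (cases "U = UNIV")
  case True then show ?thesis by (simp add: trig_approx_const)
next
  case False
  define g where "g = (\<lambda>(n::nat) z. min 1 (real n * infdist z (- U)))"
  have g01: "0 \<le> g n z" "g n z \<le> 1" for n z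
    by (auto simp: g_def infdist_nonneg)
  have [measurable]: "U \<in> sets borel" using U by auto
  show ?thesis
  proof (rule trig_approx_limit[where U = "\<lambda>n t. of_real (g n (fmode b 1 t))" and g = "\<lambda>_. 1"])
    show "(\<lambda>t. indicator U (fmode b 1 t)) \<in> borel_measurable (period b)"
      by (rule measurable_period) measurable
    show "trig_approx b (\<lambda>t. complex_of_real (g n (fmode b 1 t)))" for n
      by (rule trig_approx_continuous[OF _ b])
        (auto simp: g_def intro!: continuous_intros)
    show "(\<integral>\<^sup>+t. ennreal (1\<^sup>2) \<partial>period b) < \<infinity>"
      using nn_integral_period_const[where r = 1 and b = b] by simp
    fix t
    have "norm (indicator U z - complex_of_real (g i z)) \<le> 1" for i z
    proof -
      have "indicator U z - complex_of_real (g i z) = complex_of_real (indicator U z - g i z)"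
        by (simp add: indicator_def)
      then have "norm (indicator U z - complex_of_real (g i z)) = \<bar>indicator U z - g i z\<bar>"
        by (simp only: norm_of_real)
      then show ?thesis using g01[of i z] by (auto simp: indicator_def)
    qed
    then show "norm (indicator U (fmode b 1 t) - complex_of_real (g i (fmode b 1 t))) \<le> 1" for i .
    have "(\<lambda>i. complex_of_real (g i z)) \<longlonglongrightarrow> indicator U z" for z
    proof (cases "z \<in> U")
      case True
      then have "infdist z (- U) > 0"
        using U False in_closed_iff_infdist_zero[of "- U" z] infdist_nonneg[of z "- U"] by fastforce
      then obtain n0 :: nat where n0: "1 < real n0 * infdist z (- U)"
        using reals_Archimedean3 by blast
      have "\<forall>\<^sub>F i in sequentially. complex_of_real (g i z) = indicator U z"
      proof (rule eventually_sequentiallyI[of n0])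
        fix i assume "n0 \<le> i"
        then have "real n0 * infdist z (- U) \<le> real i * infdist z (- U)"
          by (intro mult_right_mono) (auto simp: infdist_nonneg)
        then show "complex_of_real (g i z) = indicator U z" using n0 True by (simp add: g_def)
      qed
      then show ?thesis by (rule tendsto_eventually)
    next
      case False
      then have "g i z = 0" for i by (simp add: g_def)
      then show ?thesis using False by simp
    qed
    then show "(\<lambda>i. complex_of_real (g i (fmode b 1 t))) \<longlonglongrightarrow> indicator U (fmode b 1 t)" .
  qed auto
qed

text \<open>Dynkin's argument: open sets form an intersection-stable generator, and approximability
  of indicators passes to complements and, by dominated convergence, to countable disjoint
  unions.\<close>

lemma trig_approx_borel:
  assumes A: "A \<in> sets borel" and b: "0 < b"
  shows "trig_approx b (\<lambda>t. indicator A (fmode b 1 t))"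
proof -
  have "Int_stable {S :: complex set. open S}" "{S :: complex set. open S} \<subseteq> Pow UNIV"
    "A \<in> sigma_sets UNIV {S. open S}"
    using A by (auto simp: Int_stable_def borel_def)
  then show ?thesis
  proof (induction rule: sigma_sets_induct_disjoint)
    case (compl A)
    have "trig_approx b (\<lambda>t. 1 + (-1) * indicator A (fmode b 1 t))"
      using compl by (intro trig_approx_add trig_approx_cmult trig_approx_const)
    then show ?case
      by (rule trig_approx_cong) (auto simp: indicator_def)
  next
    case (union A)
    have [measurable]: "A i \<in> sets borel" for i
      using union(2) by (auto simp: borel_def)
    have eq: "(\<Sum>i<n. indicator (A i) z) = (indicator (\<Union>i<n. A i) z :: complex)" for n z
      by (rule indicator_UN_disjoint[symmetric])
        (use union(1) in \<open>auto simp: disjoint_family_on_def\<close>)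
    show ?case
    proof (rule trig_approx_limit[where U = "\<lambda>n t. \<Sum>i<n. indicator (A i) (fmode b 1 t)" and g = "\<lambda>_. 1"])
      have [measurable]: "\<Union> (range A) \<in> sets borel" by (rule sets.countable_UN) auto
      show "(\<lambda>t. indicator (\<Union> (range A)) (fmode b 1 t)) \<in> borel_measurable (period b)"
        by (rule measurable_period) measurable
      show "trig_approx b (\<lambda>t. \<Sum>i<n. indicator (A i) (fmode b 1 t))" for n
        by (induction n) (auto simp: trig_approx_const intro!: trig_approx_add union)
      show "(\<integral>\<^sup>+t. ennreal (1\<^sup>2) \<partial>period b) < \<infinity>"
        using nn_integral_period_const[where r = 1 and b = b] by simp
      show "(\<lambda>n. \<Sum>i<n. indicator (A i) (fmode b 1 t)) \<longlonglongrightarrow> (indicator (\<Union> (range A)) (fmode b 1 t) :: complex)" for t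
        unfolding eq by (rule LIMSEQ_indicator_UN)
      show "norm (indicator (\<Union> (range A)) (fmode b 1 t) - (\<Sum>i<n. indicator (A i) (fmode b 1 t)) :: complex) \<le> 1" for n t
        unfolding eq by (auto simp: indicator_def)
    qed auto
  qed (auto simp: trig_approx_const trig_approx_open b)
qed

text \<open>A Borel angle function: \<open>arccos\<close> of the real part, reflected in the lower
  half plane. Clamping the real part to [-1, 1] makes the function \<open>A\<close> continuous on
  the whole plane.\<close>

lemma cis_angle_measurable_inverse:
  obtains \<tau> :: "complex \<Rightarrow> real" where "\<tau> \<in> borel_measurable borel"
    "\<And>x. 0 \<le> x \<Longrightarrow> x < 2 * pi \<Longrightarrow> \<tau> (cis x) = x"
proof
  define A where "A = (\<lambda>z. arccos (max (-1) (min 1 (Re z))))"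
  have "continuous_on UNIV A"
    unfolding A_def by (intro continuous_intros) auto
  then have [measurable]: "A \<in> borel_measurable borel"
    by (rule borel_measurable_continuous_onI)
  show "(\<lambda>z. if 0 \<le> Im z then A z else 2 * pi - A z) \<in> borel_measurable borel"
    by measurable
  fix x :: real assume x: "0 \<le> x" "x < 2 * pi"
  have A: "A (cis x) = arccos (cos x)" by (simp add: A_def)
  show "(if 0 \<le> Im (cis x) then A (cis x) else 2 * pi - A (cis x)) = x"
  proof (cases "x \<le> pi")
    case True
    then show ?thesis using x sin_ge_zero[of x] by (simp add: A arccos_cos)
  next
    case False
    then have "sin x < 0" using x by (simp add: sin_lt_zero)
    moreover have "arccos (cos x) = 2 * pi - x"
      using arccos_cos[of "2 * pi - x"] x False by (simp add: cos_diff)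
    ultimately show ?thesis by (simp add: A)
  qed
qed

text \<open>The angle function pulls a Borel set of base points back to a Borel set of the plane,
  which transfers the result from the circle to the period.\<close>

lemma trig_approx_indicator:
  assumes B: "B \<in> sets borel" and b: "0 < b"
  shows "trig_approx b (indicator B)"
proof -
  obtain \<tau> :: "complex \<Rightarrow> real" where [measurable]: "\<tau> \<in> borel_measurable borel"
    and \<tau>: "\<And>x. 0 \<le> x \<Longrightarrow> x < 2 * pi \<Longrightarrow> \<tau> (cis x) = x"
    using cis_angle_measurable_inverse by blast
  have "{z. \<tau> z * b / (2 * pi) \<in> B} \<in> sets borel"
    using B by measurable
  from trig_approx_borel[OF this b] show ?thesis
  proof (rule trig_approx_cong)
    fix t assume t: "t \<in> {0..<b}"
    then have "\<tau> (fmode b 1 t) = 2 * pi * t / b"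
      unfolding fmode_def using b by (subst \<tau>) (auto simp: field_simps)
    then show "indicator {z. \<tau> z * b / (2 * pi) \<in> B} (fmode b 1 t) = (indicator B t :: complex)"
      using b by (simp add: indicator_def)
  qed
qed

text \<open>Standard induction from indicators to nonnegative measurable functions. Summands and
  approximants are dominated by the final function, so they inherit its square
  integrability.\<close>

lemma trig_approx_nonneg:
  assumes "u \<in> borel_measurable (period b)" "\<And>t. 0 \<le> u t"
    and "(\<integral>\<^sup>+t. ennreal ((u t)\<^sup>2) \<partial>period b) < \<infinity>" and b: "0 < b"
  shows "trig_approx b (\<lambda>t. of_real (u t))"
  using assms(1-3)
proof (induction rule: borel_measurable_induct_real)
  case (set A)
  then have "A \<in> sets borel" by (auto simp: sets_restrict_space)
  from trig_approx_indicator[OF this b] show ?case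
    by (rule trig_approx_cong) (simp add: indicator_def)
next
  case (mult u c)
  show ?case
  proof (cases "c = 0")
    case False
    have [measurable]: "u \<in> borel_measurable (period b)" by fact
    have "ennreal (c\<^sup>2) * (\<integral>\<^sup>+t. ennreal ((u t)\<^sup>2) \<partial>period b) < \<infinity>"
      using mult.prems by (simp add: power_mult_distrib ennreal_mult' nn_integral_cmult)
    then have "(\<integral>\<^sup>+t. ennreal ((u t)\<^sup>2) \<partial>period b) < \<infinity>"
      using False by (auto simp: ennreal_mult_less_top)
    then show ?thesis using mult.IH trig_approx_cmult[of b _ "of_real c"] by simp
  qed (simp add: trig_approx_const)
next
  case (add u v)
  have "(\<integral>\<^sup>+t. ennreal ((u t)\<^sup>2) \<partial>period b) \<le> (\<integral>\<^sup>+t. ennreal ((v t + u t)\<^sup>2) \<partial>period b)"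
    using add.hyps by (intro nn_integral_mono ennreal_leI power_mono) auto
  moreover have "(\<integral>\<^sup>+t. ennreal ((v t)\<^sup>2) \<partial>period b) \<le> (\<integral>\<^sup>+t. ennreal ((v t + u t)\<^sup>2) \<partial>period b)"
    using add.hyps by (intro nn_integral_mono ennreal_leI power_mono) auto
  ultimately show ?case
    using add.prems add.IH by (auto intro!: trig_approx_add simp: le_less_trans)
next
  case (seq U)
  have le: "U i t \<le> u t" if "t \<in> {0..<b}" for i t
    using seq(3,4) that by (intro incseq_le) (auto simp: incseq_def le_fun_def)
  have fin: "(\<integral>\<^sup>+t. ennreal ((U i t)\<^sup>2) \<partial>period b) < \<infinity>" for i
  proof -
    have "(\<integral>\<^sup>+t. ennreal ((U i t)\<^sup>2) \<partial>period b) \<le> (\<integral>\<^sup>+t. ennreal ((u t)\<^sup>2) \<partial>period b)"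
      using le seq by (intro nn_integral_mono ennreal_leI power_mono) auto
    then show ?thesis using seq.prems by (rule le_less_trans)
  qed
  have [measurable]: "u \<in> borel_measurable (period b)" by fact
  show ?case
  proof (rule trig_approx_limit[where U = "\<lambda>i t. of_real (U i t)" and g = u])
    fix i t assume t: "t \<in> {0..<b}"
    have "norm (complex_of_real (u t) - complex_of_real (U i t)) = \<bar>u t - U i t\<bar>"
      by (simp flip: of_real_diff)
    then show "norm (complex_of_real (u t) - complex_of_real (U i t)) \<le> u t"
      using le[OF t, of i] seq.hyps(2)[of i t] by simp
  next
    fix t assume "t \<in> {0..<b}"
    then show "(\<lambda>i. complex_of_real (U i t)) \<longlonglongrightarrow> complex_of_real (u t)"
      using seq by (intro tendsto_of_real) auto
  qed (use seq.prems seq.IH fin in auto)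
qed

lemma trig_approx_square_integrable:
  assumes F [measurable]: "F \<in> borel_measurable (period b)"
    and fin: "(\<integral>\<^sup>+t. ennreal ((norm (F t))\<^sup>2) \<partial>period b) < \<infinity>" and b: "0 < b"
  shows "trig_approx b F"
proof -
  have *: "trig_approx b (\<lambda>t. of_real (u t))"
    if [measurable]: "u \<in> borel_measurable (period b)" and u: "\<And>t. 0 \<le> u t" "\<And>t. u t \<le> norm (F t)" for u
  proof (rule trig_approx_nonneg[OF _ _ _ b])
    have "(\<integral>\<^sup>+t. ennreal ((u t)\<^sup>2) \<partial>period b) \<le> (\<integral>\<^sup>+t. ennreal ((norm (F t))\<^sup>2) \<partial>period b)"
      using u by (intro nn_integral_mono ennreal_leI power_mono) auto
    then show "(\<integral>\<^sup>+t. ennreal ((u t)\<^sup>2) \<partial>period b) < \<infinity>" using fin by (rule le_less_trans)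
  qed (use u in auto)
  \<comment> \<open>Decomposition into positive and negative parts of the real and imaginary part,
    each bounded by the modulus of \<open>F\<close>.\<close>
  have "trig_approx b (\<lambda>t. (of_real (max 0 (Re (F t))) + (-1) * of_real (max 0 (- Re (F t)))) +
      (\<i> * of_real (max 0 (Im (F t))) + (-\<i>) * of_real (max 0 (- Im (F t)))))"
    by (intro trig_approx_add trig_approx_cmult *)
      (auto simp: abs_Re_le_cmod abs_Im_le_cmod intro: order_trans[OF abs_ge_self] order_trans[OF abs_ge_minus_self])
  then show ?thesis
    by (rule trig_approx_cong) (auto simp: complex_eq_iff max_def)
qed

section \<open>Fourier coefficients, Bessel's inequality and Parseval's identity\<close>

lemma period_L2_imp_integrable:
  assumes F [measurable]: "F \<in> borel_measurable (period b)"
    and fin: "(\<integral>\<^sup>+t. ennreal ((norm (F t :: complex))\<^sup>2) \<partial>period b) < \<infinity>"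
  shows "integrable (period b) (\<lambda>t. (norm (F t))\<^sup>2)" "integrable (period b) F"
proof -
  show sq: "integrable (period b) (\<lambda>t. (norm (F t))\<^sup>2)"
    using fin by (intro integrableI_bounded) auto
  interpret finite_measure "period b" by (rule finite_measure_period)
  show "integrable (period b) F"
  proof (rule Bochner_Integration.integrable_bound)
    show "integrable (period b) (\<lambda>t. 1 + (norm (F t))\<^sup>2)" using sq by auto
    show "AE t in period b. norm (F t) \<le> norm (1 + (norm (F t))\<^sup>2)"
    proof (rule AE_I2)
      fix t
      \<comment> \<open>This square yields |F| at most |F|^2 + 1/4, and constants are integrable
        because a period has finite measure.\<close>
      have "0 \<le> (norm (F t) - 1/2)\<^sup>2" by simp
      then have "norm (F t) \<le> 1 + (norm (F t))\<^sup>2"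
        by (simp add: power2_eq_square algebra_simps)
      then show "norm (F t) \<le> norm (1 + (norm (F t))\<^sup>2)" by simp
    qed
  qed measurable
qed

lemma integrable_mult_fmode:
  assumes F: "integrable (period b) F"
  shows "integrable (period b) (\<lambda>t. F t * fmode b k t)"
proof (rule Bochner_Integration.integrable_bound[OF F])
  have [measurable]: "F \<in> borel_measurable (period b)" using F by auto
  have [measurable]: "fmode b k \<in> borel_measurable (period b)" by (rule measurable_period) measurable
  show "(\<lambda>t. F t * fmode b k t) \<in> borel_measurable (period b)" by measurable
qed (simp add: norm_mult)

text \<open>Completing the square in the coefficients. One identity serves twice: \<alpha> equal to
  \<open>c k / b\<close> gives Bessel's inequality, and an arbitrary approximating polynomial gives
  completeness.\<close>

lemma trig_distance_identity:
  fixes \<alpha> :: "int \<Rightarrow> complex"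
  assumes F [measurable]: "F \<in> borel_measurable (period b)"
    and fin: "(\<integral>\<^sup>+t. ennreal ((norm (F t))\<^sup>2) \<partial>period b) < \<infinity>"
    and b: "0 < b" and S: "finite S"
  defines "c \<equiv> \<lambda>k. LINT t|period b. F t * fmode b (- k) t"
  defines "T \<equiv> \<lambda>t. \<Sum>k\<in>S. \<alpha> k * fmode b k t"
  shows "integrable (period b) (\<lambda>t. (norm (F t - T t))\<^sup>2)"
    "(LINT t|period b. (norm (F t - T t))\<^sup>2) =
      (LINT t|period b. (norm (F t))\<^sup>2) - (\<Sum>k\<in>S. (norm (c k))\<^sup>2 / b)
        + (\<Sum>k\<in>S. b * (norm (\<alpha> k - c k / of_real b))\<^sup>2)"
proof -
  interpret finite_measure "period b" by (rule finite_measure_period)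
  note int = period_L2_imp_integrable[OF F fin]
  have intF: "integrable (period b) (\<lambda>t. F t * fmode b k t)" for k
    by (rule integrable_mult_fmode[OF int(2)])
  have intF': "integrable (period b) (\<lambda>t. cnj (F t) * fmode b k t)" for k
    by (rule integrable_mult_fmode) (use int(2) in simp)
  have intM: "integrable (period b) (\<lambda>t. fmode b k t)" for k
    using integrable_mult_fmode[of b "\<lambda>_. 1" k] by simp
  have c_eq: "(LINT t|period b. F t * fmode b (- k) t) = c k" for k
    by (simp add: c_def)
  have cnjc: "(LINT t|period b. cnj (F t) * fmode b k t) = cnj (c k)" for k
  proof -
    have "(LINT t|period b. cnj (F t) * fmode b k t) = (LINT t|period b. cnj (F t * fmode b (- k) t))"
      by (simp add: cnj_fmode)
    then show ?thesis unfolding c_def by (simp only: Bochner_Integration.integral_cnj)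
  qed
  \<comment> \<open>The squared modulus is expanded in complex form, since the mixed terms are not
    real individually; the last double sum collapses by orthogonality after integration.\<close>
  have pt: "of_real ((norm (F t - T t))\<^sup>2) = complex_of_real ((norm (F t))\<^sup>2)
     - (\<Sum>k\<in>S. cnj (\<alpha> k) * (F t * fmode b (- k) t))
     - (\<Sum>k\<in>S. \<alpha> k * (cnj (F t) * fmode b k t))
     + (\<Sum>k\<in>S. \<Sum>j\<in>S. \<alpha> k * cnj (\<alpha> j) * fmode b (k - j) t)" for t
  proof -
    have "of_real ((norm (F t - T t))\<^sup>2) = (F t - T t) * cnj (F t - T t)"
      by (metis complex_norm_square)
    also have "\<dots> = F t * cnj (F t) - F t * cnj (T t) - T t * cnj (F t) + T t * cnj (T t)"
      by (simp add: algebra_simps)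
    also have "F t * cnj (F t) = complex_of_real ((norm (F t))\<^sup>2)"
      by (metis complex_norm_square)
    also have "F t * cnj (T t) = (\<Sum>k\<in>S. cnj (\<alpha> k) * (F t * fmode b (- k) t))"
      by (simp add: T_def sum_distrib_left cnj_fmode mult_ac)
    also have "T t * cnj (F t) = (\<Sum>k\<in>S. \<alpha> k * (cnj (F t) * fmode b k t))"
      unfolding T_def sum_distrib_right by (intro sum.cong refl) (simp only: mult_ac)
    also have "T t * cnj (T t) = (\<Sum>k\<in>S. \<Sum>j\<in>S. \<alpha> k * cnj (\<alpha> j) * fmode b (k - j) t)"
    proof -
      have "fmode b (k - j) t = fmode b k t * fmode b (- j) t" for k j
        by (simp add: fmode_mult)
      note fm = this
      have "T t * cnj (T t) = (\<Sum>k\<in>S. \<Sum>j\<in>S. (\<alpha> k * fmode b k t) * (cnj (\<alpha> j) * fmode b (- j) t))"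
        by (simp add: T_def cnj_fmode sum_product)
      also have "\<dots> = (\<Sum>k\<in>S. \<Sum>j\<in>S. \<alpha> k * cnj (\<alpha> j) * fmode b (k - j) t)"
        unfolding fm by (intro sum.cong refl) (simp only: mult_ac)
      finally show ?thesis .
    qed
    finally show ?thesis .
  qed
  have intN: "integrable (period b) (\<lambda>t. complex_of_real ((norm (F t))\<^sup>2))"
    using int(1) by (rule integrable_of_real)
  have intC: "integrable (period b) (\<lambda>t. complex_of_real ((norm (F t - T t))\<^sup>2))"
    unfolding pt by (intro Bochner_Integration.integrable_add Bochner_Integration.integrable_diff
        Bochner_Integration.integrable_sum integrable_mult_right intN intF intF' intM)
  have "integrable (period b) (\<lambda>t. Re (complex_of_real ((norm (F t - T t))\<^sup>2)))"
    using intC by (rule integrable_Re)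
  then show intR: "integrable (period b) (\<lambda>t. (norm (F t - T t))\<^sup>2)" by simp
  have "complex_of_real (LINT t|period b. (norm (F t - T t))\<^sup>2) = (LINT t|period b. complex_of_real ((norm (F t - T t))\<^sup>2))"
    by (rule integral_complex_of_real[symmetric])
  also have "\<dots> = (LINT t|period b. complex_of_real ((norm (F t))\<^sup>2))
     - (\<Sum>k\<in>S. cnj (\<alpha> k) * c k)
     - (\<Sum>k\<in>S. \<alpha> k * cnj (c k))
     + (\<Sum>k\<in>S. \<Sum>j\<in>S. \<alpha> k * cnj (\<alpha> j) * (LINT t|period b. fmode b (k - j) t))"
    unfolding pt using intN intF intF' intM
    by (simp add: cnjc c_eq del: integral_complex_of_real of_real_power)
  also have "(\<Sum>k\<in>S. \<Sum>j\<in>S. \<alpha> k * cnj (\<alpha> j) * (LINT t|period b. fmode b (k - j) t))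
      = (\<Sum>k\<in>S. \<alpha> k * cnj (\<alpha> k) * of_real b)"
  proof (rule sum.cong[OF refl])
    fix k assume k: "k \<in> S"
    have "(\<Sum>j\<in>S. \<alpha> k * cnj (\<alpha> j) * (LINT t|period b. fmode b (k - j) t))
        = (\<Sum>j\<in>S. if k = j then \<alpha> k * cnj (\<alpha> j) * of_real b else 0)"
      by (rule sum.cong) (simp_all add: integral_fmode[OF b])
    then show "(\<Sum>j\<in>S. \<alpha> k * cnj (\<alpha> j) * (LINT t|period b. fmode b (k - j) t)) = \<alpha> k * cnj (\<alpha> k) * of_real b"
      using k S by simp
  qed
  also have "(LINT t|period b. complex_of_real ((norm (F t))\<^sup>2)) - (\<Sum>k\<in>S. cnj (\<alpha> k) * c k)
     - (\<Sum>k\<in>S. \<alpha> k * cnj (c k)) + (\<Sum>k\<in>S. \<alpha> k * cnj (\<alpha> k) * of_real b)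
     = of_real ((LINT t|period b. (norm (F t))\<^sup>2) - (\<Sum>k\<in>S. (norm (c k))\<^sup>2 / b)
        + (\<Sum>k\<in>S. b * (norm (\<alpha> k - c k / of_real b))\<^sup>2))"
  proof -
    have "of_real (b * (norm (\<alpha> k - c k / of_real b))\<^sup>2) =
        \<alpha> k * cnj (\<alpha> k) * of_real b - cnj (\<alpha> k) * c k - \<alpha> k * cnj (c k) + of_real ((norm (c k))\<^sup>2 / b)" for k
    proof -
      have "complex_of_real (b * (norm (\<alpha> k - c k / of_real b))\<^sup>2) =
          of_real b * ((\<alpha> k - c k / of_real b) * cnj (\<alpha> k - c k / of_real b))"
        by (metis complex_norm_square of_real_mult)
      also have "\<dots> = \<alpha> k * cnj (\<alpha> k) * of_real b - cnj (\<alpha> k) * c k - \<alpha> k * cnj (c k) + (c k * cnj (c k)) / of_real b"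
        using b by (simp add: field_simps)
      also have "c k * cnj (c k) = of_real ((norm (c k))\<^sup>2)" by (metis complex_norm_square)
      finally show ?thesis by simp
    qed
    then have "of_real (\<Sum>k\<in>S. b * (norm (\<alpha> k - c k / of_real b))\<^sup>2) =
        (\<Sum>k\<in>S. \<alpha> k * cnj (\<alpha> k) * of_real b) - (\<Sum>k\<in>S. cnj (\<alpha> k) * c k) - (\<Sum>k\<in>S. \<alpha> k * cnj (c k))
        + of_real (\<Sum>k\<in>S. (norm (c k))\<^sup>2 / b)"
      by (simp add: sum.distrib sum_subtractf del: of_real_mult of_real_power of_real_divide)
    then show ?thesis
      by (simp del: of_real_mult of_real_power of_real_divide of_real_sum)
  qed
  finally show "(LINT t|period b. (norm (F t - T t))\<^sup>2) =
      (LINT t|period b. (norm (F t))\<^sup>2) - (\<Sum>k\<in>S. (norm (c k))\<^sup>2 / b)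
        + (\<Sum>k\<in>S. b * (norm (\<alpha> k - c k / of_real b))\<^sup>2)"
    by (simp only: of_real_eq_iff)
qed

lemma nn_integral_count_space_int_le:
  fixes f :: "int \<Rightarrow> ennreal"
  assumes "\<And>S. finite S \<Longrightarrow> sum f S \<le> C"
  shows "(\<integral>\<^sup>+k. f k \<partial>count_space UNIV) \<le> C"
proof -
  have "(\<integral>\<^sup>+k. f k \<partial>count_space UNIV) = (\<integral>\<^sup>+n. f (int_decode n) \<partial>count_space UNIV)"
    by (rule nn_integral_bij_count_space[symmetric]) (rule bij_int_decode)
  also have "\<dots> = (\<Sum>n. f (int_decode n))" by (rule nn_integral_count_space_nat)
  also have "\<dots> \<le> C"
  proof (rule suminf_le_const)
    fix n
    have "(\<Sum>i<n. f (int_decode i)) = sum f (int_decode ` {..<n})"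
      by (simp add: sum.reindex inj_int_decode)
    then show "(\<Sum>i<n. f (int_decode i)) \<le> C" using assms by simp
  qed auto
  finally show ?thesis .
qed

lemma sum_le_nn_integral_count_space:
  "finite S \<Longrightarrow> sum f S \<le> (\<integral>\<^sup>+k. f k \<partial>count_space UNIV)"
proof -
  assume "finite S"
  then have "sum f S = (\<integral>\<^sup>+k. f k * indicator S k \<partial>count_space UNIV)"
    by (subst nn_integral_count_space'[of S]) (auto intro!: sum.cong)
  also have "\<dots> \<le> (\<integral>\<^sup>+k. f k \<partial>count_space UNIV)"
    by (intro nn_integral_mono) (auto simp: indicator_def)
  finally show ?thesis .
qed

theorem parseval_period:
  assumes F [measurable]: "F \<in> borel_measurable (period b)"
    and fin: "(\<integral>\<^sup>+t. ennreal ((norm (F t))\<^sup>2) \<partial>period b) < \<infinity>"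
    and b: "0 < b"
  shows "(\<integral>\<^sup>+k. ennreal ((norm (LINT t|period b. F t * fmode b k t))\<^sup>2) \<partial>count_space UNIV)
    = ennreal b * (\<integral>\<^sup>+t. ennreal ((norm (F t))\<^sup>2) \<partial>period b)"
proof -
  define c where "c = (\<lambda>k. LINT t|period b. F t * fmode b (- k) t)"
  define N where "N = (LINT t|period b. (norm (F t))\<^sup>2)"
  define L where "L = (\<integral>\<^sup>+k. ennreal ((norm (c k))\<^sup>2) \<partial>count_space UNIV)"
  note int = period_L2_imp_integrable[OF F fin]
  have NN: "(\<integral>\<^sup>+t. ennreal ((norm (F t))\<^sup>2) \<partial>period b) = ennreal N"
    unfolding N_def by (rule nn_integral_eq_integral[OF int(1)]) simp
  have N0: "0 \<le> N" unfolding N_def by simp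
  \<comment> \<open>Bessel: with the optimal coefficients the last sum of the identity vanishes, and
    what remains is a nonnegative squared distance.\<close>
  have "L \<le> ennreal (b * N)"
    unfolding L_def
  proof (rule nn_integral_count_space_int_le)
    fix S :: "int set" assume S: "finite S"
    have "N - (\<Sum>k\<in>S. (norm (c k))\<^sup>2 / b) =
        (LINT t|period b. (norm (F t - (\<Sum>k\<in>S. c k / of_real b * fmode b k t)))\<^sup>2)"
      using trig_distance_identity(2)[OF F fin b S, of "\<lambda>k. c k / of_real b"]
      by (simp add: c_def N_def)
    also have "\<dots> \<ge> 0" by (rule Bochner_Integration.integral_nonneg) simp
    finally have "0 \<le> N - (\<Sum>k\<in>S. (norm (c k))\<^sup>2 / b)" .
    then have "(\<Sum>k\<in>S. (norm (c k))\<^sup>2) \<le> b * N"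
      using b by (simp add: sum_divide_distrib[symmetric] field_simps)
    then show "(\<Sum>k\<in>S. ennreal ((norm (c k))\<^sup>2)) \<le> ennreal (b * N)"
      by (simp add: ennreal_leI)
  qed
  \<comment> \<open>Completeness: for a polynomial within squared distance \<open>e / b\<close>,
    dropping the nonnegative last sum of the identity bounds \<open>N\<close> by a finite part of
    the coefficient series plus the error.\<close>
  moreover have "ennreal (b * N) \<le> L"
  proof (rule ennreal_le_epsilon)
    fix e :: real assume e: "0 < e"
    have "trig_approx b F" by (rule trig_approx_square_integrable[OF F fin b])
    then obtain S \<alpha> where S: "finite S"
      and le: "sqdist b F (\<lambda>t. \<Sum>k\<in>S. \<alpha> k * fmode b k t) \<le> ennreal (e / b)"
      using e b unfolding trig_approx_def trig_def by (smt (verit, ccfv_threshold) divide_pos_pos mem_Collect_eq)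
    note id = trig_distance_identity[OF F fin b S, of \<alpha>]
    have "sqdist b F (\<lambda>t. \<Sum>k\<in>S. \<alpha> k * fmode b k t) =
       ennreal (LINT t|period b. (norm (F t - (\<Sum>k\<in>S. \<alpha> k * fmode b k t)))\<^sup>2)"
      unfolding sqdist_def by (rule nn_integral_eq_integral[OF id(1)]) simp
    with le have "(LINT t|period b. (norm (F t - (\<Sum>k\<in>S. \<alpha> k * fmode b k t)))\<^sup>2) \<le> e / b"
      using e b by simp
    then have "N - (\<Sum>k\<in>S. (norm (c k))\<^sup>2 / b) \<le> e / b"
      using sum_nonneg[of S "\<lambda>k. b * (norm (\<alpha> k - c k / of_real b))\<^sup>2"] b
      unfolding id(2) c_def N_def by simp
    then have "N \<le> ((\<Sum>k\<in>S. (norm (c k))\<^sup>2) + e) / b"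
      by (simp add: sum_divide_distrib[symmetric] add_divide_distrib)
    then have "b * N \<le> (\<Sum>k\<in>S. (norm (c k))\<^sup>2) + e"
      using b by (simp only: pos_le_divide_eq mult.commute)
    then have "ennreal (b * N) \<le> ennreal ((\<Sum>k\<in>S. (norm (c k))\<^sup>2) + e)"
      by (rule ennreal_leI)
    also have "\<dots> = (\<Sum>k\<in>S. ennreal ((norm (c k))\<^sup>2)) + ennreal e"
      using e by (simp add: sum_nonneg)
    also have "\<dots> \<le> L + ennreal e"
      unfolding L_def by (intro add_right_mono sum_le_nn_integral_count_space S)
    finally show "ennreal (b * N) \<le> L + ennreal e" .
  qed
  ultimately have "L = ennreal b * ennreal N"
    using b N0 by (simp add: ennreal_mult)
  \<comment> \<open>Coefficients against \<open>fmode b k\<close> and \<open>fmode b (- k)\<close>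
    are the same family in another order.\<close>
  moreover have "(\<integral>\<^sup>+k. ennreal ((norm (LINT t|period b. F t * fmode b k t))\<^sup>2) \<partial>count_space UNIV)
     = (\<integral>\<^sup>+k. ennreal ((norm (LINT t|period b. F t * fmode b (- k) t))\<^sup>2) \<partial>count_space UNIV)"
    by (rule nn_integral_bij_count_space[symmetric, of uminus]) (simp add: bij_uminus)
  ultimately show ?thesis by (simp add: L_def c_def NN)
qed

section \<open>Stability of the window sums\<close>

definition window :: "real \<Rightarrow> real \<Rightarrow> real \<Rightarrow> real \<Rightarrow> int \<Rightarrow> int set" where
  "window a b c t m = {k. 0 \<le> t + of_int k * b - of_int m * a \<and> t + of_int k * b - of_int m * a < c}"

definition wsum :: "real \<Rightarrow> real \<Rightarrow> real \<Rightarrow> real \<Rightarrow> (int \<Rightarrow> complex) \<Rightarrow> int \<Rightarrow> complex" where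
  "wsum a b c t z m = sum z (window a b c t m)"

definition energy :: "int set \<Rightarrow> (int \<Rightarrow> complex) \<Rightarrow> ennreal" where
  "energy S z = (\<integral>\<^sup>+k. ennreal ((norm (z k))\<^sup>2) * indicator S k \<partial>count_space UNIV)"

text \<open>The point is uniformity: the count depends on the length \<open>c\<close> but not on the
  position \<open>x\<close>.\<close>

lemma ints_in_interval:
  fixes b x c :: real
  assumes "0 < b"
  shows "finite {k :: int. x \<le> of_int k * b \<and> of_int k * b < x + c}"
    "card {k :: int. x \<le> of_int k * b \<and> of_int k * b < x + c} \<le> nat (\<lceil>c / b\<rceil> + 1)"
proof -
  let ?S = "{k :: int. x \<le> of_int k * b \<and> of_int k * b < x + c}"
  have sub: "?S \<subseteq> {\<lceil>x / b\<rceil>..\<lceil>x / b\<rceil> + \<lceil>c / b\<rceil>}"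
  proof
    fix k assume "k \<in> ?S"
    then have "x / b \<le> of_int k" "of_int k < x / b + c / b"
      using assms by (auto simp: field_simps)
    then have "\<lceil>x / b\<rceil> \<le> k" "of_int k \<le> of_int \<lceil>x / b\<rceil> + (of_int \<lceil>c / b\<rceil> :: real)"
      by linarith+
    then show "k \<in> {\<lceil>x / b\<rceil>..\<lceil>x / b\<rceil> + \<lceil>c / b\<rceil>}" by simp
  qed
  then show "finite ?S" by (rule finite_subset) simp
  have "card ?S \<le> card {\<lceil>x / b\<rceil>..\<lceil>x / b\<rceil> + \<lceil>c / b\<rceil>}" by (rule card_mono[OF _ sub]) simp
  then show "card ?S \<le> nat (\<lceil>c / b\<rceil> + 1)" by simp
qed

lemma window_bounds:
  assumes "0 < b"
  shows "finite (window a b c t m)" "card (window a b c t m) \<le> nat (\<lceil>c / b\<rceil> + 1)"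
proof -
  have "window a b c t m = {k. of_int m * a - t \<le> of_int k * b \<and> of_int k * b < (of_int m * a - t) + c}"
    by (auto simp: window_def)
  then show "finite (window a b c t m)" "card (window a b c t m) \<le> nat (\<lceil>c / b\<rceil> + 1)"
    using ints_in_interval[OF assms, of "of_int m * a - t" c] by auto
qed

lemma window_converse_bounds:
  assumes "0 < a"
  shows "finite {m. k \<in> window a b c t m}" "card {m. k \<in> window a b c t m} \<le> nat (\<lceil>c / a\<rceil> + 1)"
proof -
  let ?y = "t + of_int k * b"
  \<comment> \<open>Solved for \<open>m\<close>, the condition describes an interval open at its
    left end; the sign change turns it into the half-open form counted before.\<close>
  have "{m. k \<in> window a b c t m} = uminus ` {m. - ?y \<le> of_int m * a \<and> of_int m * a < - ?y + c}"
    (is "?L = uminus ` ?R")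
  proof
    show "?L \<subseteq> uminus ` ?R"
    proof
      fix m assume "m \<in> ?L"
      then have "- m \<in> ?R" by (auto simp: window_def)
      then show "m \<in> uminus ` ?R" by (rule image_eqI[rotated]) simp
    qed
  qed (auto simp: window_def)
  moreover have "card (uminus ` ?R) = card ?R" by (rule card_image) simp
  ultimately show "finite ?L" "card ?L \<le> nat (\<lceil>c / a\<rceil> + 1)"
    using ints_in_interval[OF assms, of "- ?y" c] by auto
qed

lemma norm_sum_sq_le:
  fixes y :: "'i \<Rightarrow> complex"
  shows "(norm (sum y A))\<^sup>2 \<le> of_nat (card A) * (\<Sum>i\<in>A. (norm (y i))\<^sup>2)"
proof -
  have "(norm (sum y A))\<^sup>2 \<le> (\<Sum>i\<in>A. norm (y i))\<^sup>2"
    by (intro power_mono norm_sum) auto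
  also have "\<dots> \<le> (\<Sum>i\<in>A. (norm (y i))\<^sup>2) * of_nat (card A)"
    by (rule sum_squared_le_sum_of_squares)
  finally show ?thesis by (simp add: mult.commute)
qed

lemma nn_integral_count_space_inj_le:
  assumes "inj g"
  shows "(\<integral>\<^sup>+k. f (g k) \<partial>count_space UNIV) \<le> (\<integral>\<^sup>+m. f m \<partial>count_space UNIV)"
proof -
  have "(\<integral>\<^sup>+k. f (g k) \<partial>count_space UNIV) = (\<integral>\<^sup>+m. f m \<partial>count_space (range g))"
    by (rule nn_integral_bij_count_space) (use assms in \<open>auto simp: bij_betw_def\<close>)
  also have "\<dots> = (\<integral>\<^sup>+m. f m * indicator (range g) m \<partial>count_space UNIV)"
    by (simp add: nn_integral_count_space_indicator)
  also have "\<dots> \<le> (\<integral>\<^sup>+m. f m \<partial>count_space UNIV)"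
    by (intro nn_integral_mono) (auto simp: indicator_def)
  finally show ?thesis .
qed

lemma nn_integral_count_space_shift:
  "(\<integral>\<^sup>+k. f (k + s) \<partial>count_space UNIV) = (\<integral>\<^sup>+k. f (k :: int) \<partial>count_space UNIV)"
  by (rule nn_integral_bij_count_space)
    (auto simp: bij_betw_def inj_on_def intro!: surjI[of _ "\<lambda>x. x - s"])

text \<open>Cauchy-Schwarz inside each window, then exchange of the two sums. The constant is the
  maximal number of points per window times the maximal number of windows per point, independent of
  \<open>t\<close>.\<close>

lemma energy_wsum_le:
  assumes "0 < a" "0 < b"
  shows "energy UNIV (wsum a b c t z) \<le> ennreal (real (nat (\<lceil>c / b\<rceil> + 1)) * real (nat (\<lceil>c / a\<rceil> + 1))) * energy UNIV z"
proof -
  let ?B = "nat (\<lceil>c / b\<rceil> + 1)" and ?A = "nat (\<lceil>c / a\<rceil> + 1)"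
  let ?u = "\<lambda>k. ennreal ((norm (z k))\<^sup>2)"
  have "energy UNIV (wsum a b c t z) = (\<integral>\<^sup>+m. ennreal ((norm (wsum a b c t z m))\<^sup>2) \<partial>count_space UNIV)"
    by (simp add: energy_def)
  also have "\<dots> \<le> (\<integral>\<^sup>+m. of_nat ?B * (\<integral>\<^sup>+k. ?u k * indicator (window a b c t m) k \<partial>count_space UNIV) \<partial>count_space UNIV)"
  proof (rule nn_integral_mono)
    fix m
    note wb = window_bounds[OF assms(2), of a c t m]
    have "(norm (wsum a b c t z m))\<^sup>2 \<le> of_nat (card (window a b c t m)) * (\<Sum>k\<in>window a b c t m. (norm (z k))\<^sup>2)"
      unfolding wsum_def by (rule norm_sum_sq_le)
    also have "\<dots> \<le> of_nat ?B * (\<Sum>k\<in>window a b c t m. (norm (z k))\<^sup>2)"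
      using wb(2) by (intro mult_right_mono sum_nonneg) auto
    finally have "ennreal ((norm (wsum a b c t z m))\<^sup>2) \<le> ennreal (of_nat ?B * (\<Sum>k\<in>window a b c t m. (norm (z k))\<^sup>2))"
      by (rule ennreal_leI)
    also have "\<dots> = of_nat ?B * (\<Sum>k\<in>window a b c t m. ?u k)"
      by (simp add: ennreal_mult sum_nonneg ennreal_of_nat_eq_real_of_nat del: of_nat_nat)
    also have "(\<Sum>k\<in>window a b c t m. ?u k) = (\<integral>\<^sup>+k. ?u k * indicator (window a b c t m) k \<partial>count_space UNIV)"
      by (subst nn_integral_count_space'[OF wb(1)]) (auto intro!: sum.cong)
    finally show "ennreal ((norm (wsum a b c t z m))\<^sup>2) \<le> of_nat ?B * (\<integral>\<^sup>+k. ?u k * indicator (window a b c t m) k \<partial>count_space UNIV)" .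
  qed
  also have "\<dots> = of_nat ?B * (\<integral>\<^sup>+m. \<integral>\<^sup>+k. ?u k * indicator (window a b c t m) k \<partial>count_space UNIV \<partial>count_space UNIV)"
    by (rule nn_integral_cmult) simp
  also have "(\<integral>\<^sup>+m. \<integral>\<^sup>+k. ?u k * indicator (window a b c t m) k \<partial>count_space UNIV \<partial>count_space UNIV)
      = (\<integral>\<^sup>+k. \<integral>\<^sup>+m. ?u k * indicator (window a b c t m) k \<partial>count_space UNIV \<partial>count_space UNIV)"
    by (rule nn_integral_count_space_nn_integral) auto
  also have "\<dots> \<le> (\<integral>\<^sup>+k. of_nat ?A * ?u k \<partial>count_space UNIV)"
  proof (rule nn_integral_mono)
    fix k
    note cb = window_converse_bounds[OF assms(1), of k b c t]
    have "(\<integral>\<^sup>+m. ?u k * indicator (window a b c t m) k \<partial>count_space UNIV) = (\<Sum>m\<in>{m. k \<in> window a b c t m}. ?u k)"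
      by (subst nn_integral_count_space'[OF cb(1)]) (auto intro!: sum.cong)
    also have "\<dots> = of_nat (card {m. k \<in> window a b c t m}) * ?u k" by simp
    also have "\<dots> \<le> of_nat ?A * ?u k" using cb(2) by (intro mult_right_mono) (auto simp: of_nat_mono)
    finally show "(\<integral>\<^sup>+m. ?u k * indicator (window a b c t m) k \<partial>count_space UNIV) \<le> of_nat ?A * ?u k" .
  qed
  also have "\<dots> = of_nat ?A * energy UNIV z" by (simp add: energy_def nn_integral_cmult)
  also have "of_nat ?B * (of_nat ?A * energy UNIV z) = ennreal (real ?B * real ?A) * energy UNIV z"
    by (simp add: ennreal_mult ennreal_of_nat_eq_real_of_nat mult.assoc del: of_nat_nat)
  finally show ?thesis by (simp add: mult_left_mono)
qed

lemma energy_empty [simp]: "energy {} z = 0"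
  by (simp add: energy_def)

lemma energy_mono: "S \<subseteq> T \<Longrightarrow> energy S z \<le> energy T z"
  unfolding energy_def by (intro nn_integral_mono) (auto simp: indicator_def)

lemma energy_Un_le: "energy (S \<union> T) z \<le> energy S z + energy T z"
  unfolding energy_def
  by (subst nn_integral_add[symmetric]) (auto intro!: nn_integral_mono simp: indicator_def)

section \<open>Cells, residues and the partial map given by consecutive windows\<close>

locale abc_params =
  fixes a b c :: real and d :: int and c0 :: real
  assumes a0: "0 < a" and ab: "a < b" and d1: "1 \<le> d" and c_eq: "c = of_int d * b + c0"
    and c0_lower: "b - a < c0" and c0_upper: "c0 < a"
begin

text \<open>The left end of the hole, whose right end is \<open>c0\<close> and whose length is
  \<open>b - a\<close>. The hypotheses give \<open>0 < h < c0 < a\<close>.\<close>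

abbreviation "h \<equiv> c0 + a - b"

text \<open>Equivalently, the number of the last window that contains the point, because
  \<open>a < c\<close>; \<open>residue\<close> is then the distance of the point from the start of
  that window.\<close>

definition cell :: "real \<Rightarrow> int \<Rightarrow> int" where
  "cell t k = \<lfloor>(t + of_int k * b) / a\<rfloor>"

definition residue :: "real \<Rightarrow> int \<Rightarrow> real" where
  "residue t k = t + of_int k * b - of_int (cell t k) * a"

lemma residue_bounds: "0 \<le> residue t k" "residue t k < a"
proof -
  let ?x = "t + of_int k * b"
  have "of_int \<lfloor>?x / a\<rfloor> \<le> ?x / a" "?x / a < of_int \<lfloor>?x / a\<rfloor> + 1" by linarith+
  then have "of_int \<lfloor>?x / a\<rfloor> * a \<le> ?x" "?x < (of_int \<lfloor>?x / a\<rfloor> + 1) * a"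
    using a0 by (simp_all only: pos_le_divide_eq pos_divide_less_eq)
  then show "0 \<le> residue t k" "residue t k < a"
    by (simp_all add: residue_def cell_def algebra_simps)
qed

lemma cell_residue_unique:
  assumes "t + of_int k * b = of_int n * a + r" "0 \<le> r" "r < a"
  shows "cell t k = n" "residue t k = r"
proof -
  show "cell t k = n"
    unfolding cell_def assms(1) using assms a0
    by (intro floor_unique) (auto simp: field_simps)
  then show "residue t k = r" using assms(1) by (simp add: residue_def)
qed

text \<open>Here \<open>e\<close> represents \<open>s * b\<close> modulo \<open>a\<close>; as long
  as no cell boundary is crossed modulo \<open>a\<close>, an index step by \<open>s\<close> moves
  the residue by exactly \<open>e\<close>.\<close>

lemma residue_shift:
  assumes "of_int s * b = e + of_int u * a" "0 \<le> residue t k + e" "residue t k + e < a"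
  shows "residue t (k + s) = residue t k + e"
proof (rule cell_residue_unique)
  show "t + of_int (k + s) * b = of_int (cell t k + u) * a + (residue t k + e)"
    using assms(1) by (simp add: residue_def algebra_simps)
qed (use assms in auto)

lemma int_mult_b: "1 \<le> i \<Longrightarrow> b \<le> of_int i * b" "2 \<le> i \<Longrightarrow> 2 * b \<le> of_int i * b" "i \<le> - 1 \<Longrightarrow> of_int i * b \<le> - b" for i :: int
proof -
  have b: "0 < b" using a0 ab by linarith
  have "of_int j * b \<le> of_int i * b" if "j \<le> i" for i j :: int
    using that b by (intro mult_right_mono) auto
  from this[of 1 i] this[of 2 i] this[of i "-1"]
  show "1 \<le> i \<Longrightarrow> b \<le> of_int i * b" "2 \<le> i \<Longrightarrow> 2 * b \<le> of_int i * b" "i \<le> - 1 \<Longrightarrow> of_int i * b \<le> - b"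
    by auto
qed

text \<open>Distinct points are at least \<open>b\<close> apart, while a cell is only
  \<open>a < b\<close> long. Hence sums over points of quantities attached to cells are bounded by
  sums over windows.\<close>

lemma inj_cell: "inj (cell t)"
proof (rule injI)
  fix k j assume eq: "cell t k = cell t j"
  have r: "residue t k - residue t j = of_int (k - j) * b"
    using eq by (simp add: residue_def algebra_simps)
  show "k = j"
    using int_mult_b(1,3)[of "k - j"] residue_bounds[of t k] residue_bounds[of t j] ab r
    by linarith
qed

lemma mem_window_cell:
  "j \<in> window a b c t (cell t k) \<longleftrightarrow> 0 \<le> residue t k + of_int (j - k) * b \<and> residue t k + of_int (j - k) * b < c"
  by (simp add: window_def residue_def algebra_simps)

lemma mem_window_cell_Suc:
  "j \<in> window a b c t (cell t k + 1) \<longleftrightarrow> a \<le> residue t k + of_int (j - k) * b \<and> residue t k + of_int (j - k) * b < c + a"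
  by (auto simp add: window_def residue_def algebra_simps)

definition jump :: "real \<Rightarrow> (int \<Rightarrow> complex) \<Rightarrow> int \<Rightarrow> complex" where
  "jump t z k = wsum a b c t z (cell t k) - wsum a b c t z (cell t k + 1)"

text \<open>Since \<open>a < b\<close>, moving a window by one step drops at most one point and picks up at most one.\<close>

lemma jump_eq:
  "residue t k < h \<Longrightarrow> z k = jump t z k + z (k + (d + 1))"
  "c0 \<le> residue t k \<Longrightarrow> z k = jump t z k + z (k + d)"
  "h \<le> residue t k \<Longrightarrow> residue t k < c0 \<Longrightarrow> z k = jump t z k"
proof -
  define r where "r = residue t k"
  have r: "0 \<le> r" "r < a" using residue_bounds by (auto simp: r_def)
  \<comment> \<open>The indices common to the window of \<open>k\<close> and the next one, in
    coordinates relative to the start of the former.\<close>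
  define X where "X = {j. a \<le> r + of_int (j - k) * b \<and> r + of_int (j - k) * b < c}"
  have b0: "0 < b" using a0 ab by linarith
  have db: "b \<le> of_int d * b" using int_mult_b(1)[OF d1] .
  have ac: "a < c" using db ab c0_lower c_eq by linarith
  have finX: "finite X"
  proof (rule finite_subset)
    show "X \<subseteq> window a b c t (cell t k)"
      unfolding X_def using a0 by (auto simp: mem_window_cell r_def)
    show "finite (window a b c t (cell t k))" using window_bounds(1) a0 ab by auto
  qed
  have kX: "k \<notin> X" using r by (simp add: X_def)
  \<comment> \<open>Only \<open>k\<close> drops out: every other point is at distance at least
    \<open>b\<close> from it, and the dropped stretch has length \<open>a < b\<close>.\<close>
  have "j \<in> window a b c t (cell t k) \<longleftrightarrow> j = k \<or> j \<in> X" for j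
  proof -
    define y where "y = of_int (j - k) * b"
    consider "j = k" "y = 0" | "j \<noteq> k" "b \<le> y" | "j \<noteq> k" "y \<le> - b"
      using int_mult_b(1,3)[of "j - k"] unfolding y_def by fastforce
    then show ?thesis
      using r ab a0 ac
      unfolding mem_window_cell r_def[symmetric] X_def mem_Collect_eq y_def[symmetric]
      by cases auto
  qed
  then have "window a b c t (cell t k) = insert k X" by auto
  then have W0: "wsum a b c t z (cell t k) = z k + sum z X"
    unfolding wsum_def using kX finX by simp
  have W1: "j \<in> window a b c t (cell t k + 1) \<longleftrightarrow> j \<in> X \<or> c \<le> r + of_int (j - k) * b \<and> r + of_int (j - k) * b < c + a" for j
    using a0 ac unfolding mem_window_cell_Suc r_def[symmetric] X_def mem_Collect_eq by linarith
  \<comment> \<open>A point enters through the stretch [c, c + a). Subtracting \<open>d * b\<close>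
    turns it into [c0, c0 + a), and the question is which multiple of \<open>b\<close> brings
    \<open>r\<close> there: \<open>b\<close> itself if \<open>r < h\<close>, zero if
    \<open>c0 \<le> r\<close>, and none in between.\<close>
  have enter: "c \<le> r + of_int (j - k) * b \<and> r + of_int (j - k) * b < c + a \<longleftrightarrow>
      c0 \<le> r + of_int (j - k - d) * b \<and> r + of_int (j - k - d) * b < c0 + a" for j
    by (simp add: c_eq algebra_simps)
  show "z k = jump t z k + z (k + (d + 1))" if "residue t k < h"
  proof -
    have rh: "r < h" using that by (simp add: r_def)
    have "c \<le> r + of_int (j - k) * b \<and> r + of_int (j - k) * b < c + a \<longleftrightarrow> j = k + (d + 1)" for j
    proof -
      define y where "y = of_int (j - k - d) * b"
      consider "j = k + (d + 1)" "y = b" | "j \<noteq> k + (d + 1)" "2 * b \<le> y" | "j \<noteq> k + (d + 1)" "y \<le> 0"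
      proof -
        consider "j - k - d = 1" | "2 \<le> j - k - d" | "j - k - d \<le> 0" by linarith
        then show thesis
        proof cases
          case 1
          then have "j = k + (d + 1)" "y = b" unfolding y_def by simp_all
          then show thesis by (rule that(1))
        next
          case 2
          then have "j \<noteq> k + (d + 1)" "2 * b \<le> y" using int_mult_b(2)[OF 2] unfolding y_def by auto
          then show thesis by (rule that(2))
        next
          case 3
          then have "j \<noteq> k + (d + 1)" "y \<le> 0"
            using b0 unfolding y_def by (auto intro: mult_nonpos_nonneg simp del: of_int_diff)
          then show thesis by (rule that(3))
        qed
      qed
      then show ?thesis
        using r rh ab c0_upper c0_lower unfolding enter y_def[symmetric] by cases auto
    qed
    then have "window a b c t (cell t k + 1) = insert (k + (d + 1)) X" using W1 by auto
    moreover have "k + (d + 1) \<notin> X"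
      using r c0_upper ab by (simp add: X_def c_eq algebra_simps)
    ultimately have "wsum a b c t z (cell t k + 1) = z (k + (d + 1)) + sum z X"
      unfolding wsum_def using finX by simp
    then show ?thesis by (simp add: jump_def W0)
  qed
  show "z k = jump t z k + z (k + d)" if "c0 \<le> residue t k"
  proof -
    have rh: "c0 \<le> r" using that by (simp add: r_def)
    have "c \<le> r + of_int (j - k) * b \<and> r + of_int (j - k) * b < c + a \<longleftrightarrow> j = k + d" for j
    proof -
      define y where "y = of_int (j - k - d) * b"
      consider "j = k + d" "y = 0" | "j \<noteq> k + d" "b \<le> y" | "j \<noteq> k + d" "y \<le> - b"
        using int_mult_b(1,3)[of "j - k - d"] unfolding y_def by fastforce
      then show ?thesis
        using r rh ab c0_upper c0_lower unfolding enter y_def[symmetric] by cases auto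
    qed
    then have "window a b c t (cell t k + 1) = insert (k + d) X" using W1 by auto
    moreover have "k + d \<notin> X"
      using rh by (simp add: X_def c_eq algebra_simps)
    ultimately have "wsum a b c t z (cell t k + 1) = z (k + d) + sum z X"
      unfolding wsum_def using finX by simp
    then show ?thesis by (simp add: jump_def W0)
  qed
  show "z k = jump t z k" if "h \<le> residue t k" "residue t k < c0"
  proof -
    have rh: "h \<le> r" "r < c0" using that by (auto simp: r_def)
    have "\<not> (c \<le> r + of_int (j - k) * b \<and> r + of_int (j - k) * b < c + a)" for j
    proof -
      define y where "y = of_int (j - k - d) * b"
      consider "j = k + d" "y = 0" | "j \<noteq> k + d" "b \<le> y" | "j \<noteq> k + d" "y \<le> - b"
        using int_mult_b(1,3)[of "j - k - d"] unfolding y_def by fastforce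
      then show ?thesis
        using r rh ab c0_upper c0_lower unfolding enter y_def[symmetric] by cases auto
    qed
    then have "window a b c t (cell t k + 1) = X" using W1 by auto
    then have "wsum a b c t z (cell t k + 1) = sum z X" by (simp add: wsum_def)
    then show ?thesis by (simp add: jump_def W0)
  qed
qed

section \<open>Propagation of energy bounds out of the hole\<close>

lemma energy_jump_le:
  "(\<integral>\<^sup>+k. ennreal ((norm (jump t z k))\<^sup>2) \<partial>count_space UNIV) \<le> 4 * energy UNIV (wsum a b c t z)"
proof -
  let ?f = "\<lambda>m. ennreal ((norm (wsum a b c t z m))\<^sup>2)"
  have "(\<integral>\<^sup>+k. ennreal ((norm (jump t z k))\<^sup>2) \<partial>count_space UNIV)
     \<le> (\<integral>\<^sup>+k. 2 * ?f (cell t k) + 2 * ?f (cell t k + 1) \<partial>count_space UNIV)"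
  proof (rule nn_integral_mono)
    fix k
    have "(norm (jump t z k))\<^sup>2 \<le> 2 * (norm (wsum a b c t z (cell t k)))\<^sup>2 + 2 * (norm (wsum a b c t z (cell t k + 1)))\<^sup>2"
      using norm_add_sq_le[of "wsum a b c t z (cell t k)" "- wsum a b c t z (cell t k + 1)"]
      by (simp add: jump_def)
    then have "ennreal ((norm (jump t z k))\<^sup>2) \<le> ennreal (2 * (norm (wsum a b c t z (cell t k)))\<^sup>2 + 2 * (norm (wsum a b c t z (cell t k + 1)))\<^sup>2)"
      by (rule ennreal_leI)
    then show "ennreal ((norm (jump t z k))\<^sup>2) \<le> 2 * ?f (cell t k) + 2 * ?f (cell t k + 1)"
      by (simp add: ennreal_mult')
  qed
  also have "\<dots> = 2 * (\<integral>\<^sup>+k. ?f (cell t k) \<partial>count_space UNIV) + 2 * (\<integral>\<^sup>+k. ?f (cell t k + 1) \<partial>count_space UNIV)"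
    by (simp add: nn_integral_add nn_integral_cmult)
  also have "\<dots> \<le> 2 * (\<integral>\<^sup>+m. ?f m \<partial>count_space UNIV) + 2 * (\<integral>\<^sup>+m. ?f m \<partial>count_space UNIV)"
  \<comment> \<open>By injectivity of \<open>cell\<close>, each window sum is used at most once as
    the first term and at most once as the second term of a jump.\<close>
  proof (intro add_mono mult_left_mono)
    show "(\<integral>\<^sup>+k. ?f (cell t k) \<partial>count_space UNIV) \<le> (\<integral>\<^sup>+m. ?f m \<partial>count_space UNIV)"
      by (rule nn_integral_count_space_inj_le[OF inj_cell])
    show "(\<integral>\<^sup>+k. ?f (cell t k + 1) \<partial>count_space UNIV) \<le> (\<integral>\<^sup>+m. ?f m \<partial>count_space UNIV)"
      by (rule nn_integral_count_space_inj_le[where g = "\<lambda>k. cell t k + 1"])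
        (use inj_cell[of t] in \<open>auto simp: inj_def\<close>)
  qed auto
  also have "\<dots> = 4 * energy UNIV (wsum a b c t z)"
    by (simp add: energy_def flip: distrib_right)
  finally show ?thesis .
qed

text \<open>One application of the partial map with a fixed shift \<open>s\<close>: energy on
  \<open>S\<close> is carried into \<open>S'\<close> up to jumps. The translation preserves counting
  measure, so only the factor 2 from squaring a sum is lost.\<close>

lemma energy_step:
  assumes "\<And>k. k \<in> S \<Longrightarrow> z k = jump t z k \<or> (k + s \<in> S' \<and> z k = jump t z k + z (k + s))"
  shows "energy S z \<le> 8 * energy UNIV (wsum a b c t z) + 2 * energy S' z"
proof -
  let ?g = "\<lambda>k. ennreal ((norm (z k))\<^sup>2) * indicator S' k"
  have "energy S z \<le> (\<integral>\<^sup>+k. 2 * ennreal ((norm (jump t z k))\<^sup>2) + 2 * ?g (k + s) \<partial>count_space UNIV)"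
    unfolding energy_def
  proof (rule nn_integral_mono)
    fix k
    show "ennreal ((norm (z k))\<^sup>2) * indicator S k \<le> 2 * ennreal ((norm (jump t z k))\<^sup>2) + 2 * ?g (k + s)"
    proof (cases "k \<in> S")
      case True
      from assms[OF True] show ?thesis
      proof
        assume "z k = jump t z k"
        then have "ennreal ((norm (z k))\<^sup>2) = ennreal ((norm (jump t z k))\<^sup>2)" by simp
        also have "\<dots> \<le> 2 * ennreal ((norm (jump t z k))\<^sup>2)"
          by (simp add: mult_2)
        also have "\<dots> \<le> 2 * ennreal ((norm (jump t z k))\<^sup>2) + 2 * ?g (k + s)" by simp
        finally show ?thesis using True by simp
      next
        assume *: "k + s \<in> S' \<and> z k = jump t z k + z (k + s)"
        then have "(norm (z k))\<^sup>2 \<le> 2 * (norm (jump t z k))\<^sup>2 + 2 * (norm (z (k + s)))\<^sup>2"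
          using norm_add_sq_le[of "jump t z k" "z (k + s)"] by simp
        then have "ennreal ((norm (z k))\<^sup>2) \<le> ennreal (2 * (norm (jump t z k))\<^sup>2 + 2 * (norm (z (k + s)))\<^sup>2)"
          by (rule ennreal_leI)
        then show ?thesis using True * by (simp add: ennreal_mult')
      qed
    qed simp
  qed
  also have "\<dots> = 2 * (\<integral>\<^sup>+k. ennreal ((norm (jump t z k))\<^sup>2) \<partial>count_space UNIV) + 2 * (\<integral>\<^sup>+k. ?g (k + s) \<partial>count_space UNIV)"
    by (simp add: nn_integral_add nn_integral_cmult)
  also have "(\<integral>\<^sup>+k. ?g (k + s) \<partial>count_space UNIV) = energy S' z"
    unfolding energy_def by (rule nn_integral_count_space_shift)
  also have "2 * (\<integral>\<^sup>+k. ennreal ((norm (jump t z k))\<^sup>2) \<partial>count_space UNIV) + 2 * energy S' z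
     \<le> 2 * (4 * energy UNIV (wsum a b c t z)) + 2 * energy S' z"
    by (intro add_right_mono mult_left_mono energy_jump_le) auto
  finally show ?thesis by (simp add: mult.assoc[symmetric])
qed

lemma energy_step_bound:
  assumes IH: "energy S' z \<le> ennreal C * energy UNIV (wsum a b c t z)" and C: "0 \<le> C"
    and "\<And>k. k \<in> S \<Longrightarrow> z k = jump t z k \<or> (k + s \<in> S' \<and> z k = jump t z k + z (k + s))"
  shows "energy S z \<le> ennreal (8 + 2 * C) * energy UNIV (wsum a b c t z)"
proof -
  have "energy S z \<le> 8 * energy UNIV (wsum a b c t z) + 2 * energy S' z"
    using assms(3) by (rule energy_step)
  also have "\<dots> \<le> 8 * energy UNIV (wsum a b c t z) + 2 * (ennreal C * energy UNIV (wsum a b c t z))"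
    by (intro add_left_mono mult_left_mono IH) auto
  also have "\<dots> = ennreal (8 + 2 * C) * energy UNIV (wsum a b c t z)"
    using C by (simp add: ennreal_mult' distrib_right mult.assoc)
  finally show ?thesis .
qed

text \<open>A step by \<open>d + 1\<close> moves residues left of the hole to the right by
  \<open>e\<close>. Since \<open>e\<close> is at most the hole length \<open>b - a\<close>, the hole
  cannot be jumped over. Induction on \<open>j\<close> widens the controlled strip by
  \<open>e\<close> per step; finitely many steps reach 0.\<close>

lemma energy_left_bound:
  assumes "0 < e" "e \<le> b - a" "of_int (d + 1) * b = e + of_int u * a"
  obtains C where "0 \<le> C" "\<And>t z. energy {k. residue t k < c0} z \<le> ennreal C * energy UNIV (wsum a b c t z)"
proof -
  have "\<exists>C\<ge>0. \<forall>t z. energy {k. h - of_nat j * e \<le> residue t k \<and> residue t k < c0} z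
      \<le> ennreal C * energy UNIV (wsum a b c t z)" for j :: nat
  proof (induction j)
    case 0
    show ?case
    proof (intro exI[of _ "8 + 2 * 0"] conjI allI)
      fix t z
      show "energy {k. h - of_nat 0 * e \<le> residue t k \<and> residue t k < c0} z
         \<le> ennreal (8 + 2 * 0) * energy UNIV (wsum a b c t z)"
        \<comment> \<open>In the hole itself \<open>z\<close> equals the jump, so nothing has to be
          carried on and the empty target set suffices.\<close>
        by (rule energy_step_bound[where S' = "{}" and s = 0]) (auto intro: jump_eq(3))
    qed auto
  next
    case (Suc j)
    then obtain C where C: "0 \<le> C" "\<And>t z. energy {k. h - of_nat j * e \<le> residue t k \<and> residue t k < c0} z
      \<le> ennreal C * energy UNIV (wsum a b c t z)" by blast
    show ?case
    proof (intro exI[of _ "8 + 2 * C"] conjI allI)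
      fix t z
      show "energy {k. h - of_nat (Suc j) * e \<le> residue t k \<and> residue t k < c0} z
         \<le> ennreal (8 + 2 * C) * energy UNIV (wsum a b c t z)"
      proof (rule energy_step_bound[OF C(2) C(1), where s = "d + 1"])
        fix k assume k: "k \<in> {k. h - of_nat (Suc j) * e \<le> residue t k \<and> residue t k < c0}"
        show "z k = jump t z k \<or>
          (k + (d + 1) \<in> {k. h - of_nat j * e \<le> residue t k \<and> residue t k < c0} \<and> z k = jump t z k + z (k + (d + 1)))"
        proof (cases "residue t k < h")
          case True
          have "residue t (k + (d + 1)) = residue t k + e"
            using assms True residue_bounds[of t k] c0_upper by (intro residue_shift[where u = u]) auto
          then show ?thesis using True k assms by (intro disjI2 conjI jump_eq(1)) (auto simp: algebra_simps)
        next
          case False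
          then show ?thesis using k jump_eq(3)[of t k z] by auto
        qed
      qed
    qed (use C in auto)
  qed
  moreover obtain j :: nat where j: "h < of_nat j * e"
    using reals_Archimedean3[OF assms(1)] by blast
  ultimately obtain C where C: "0 \<le> C" "\<And>t z. energy {k. h - of_nat j * e \<le> residue t k \<and> residue t k < c0} z
      \<le> ennreal C * energy UNIV (wsum a b c t z)" by blast
  have "h - of_nat j * e \<le> residue t k" for t k
    using j residue_bounds(1)[of t k] by linarith
  then show ?thesis using that[of C] C by simp
qed

text \<open>The mirror image: a step by \<open>d\<close> moves residues right of the hole to the
  left by \<open>e\<close>, again without jumping over it.\<close>

lemma energy_right_bound:
  assumes "0 < e" "e \<le> b - a" "of_int d * b = - e + of_int u * a"
  obtains C where "0 \<le> C" "\<And>t z. energy {k. h \<le> residue t k} z \<le> ennreal C * energy UNIV (wsum a b c t z)"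
proof -
  have "\<exists>C\<ge>0. \<forall>t z. energy {k. h \<le> residue t k \<and> residue t k < c0 + of_nat j * e} z
      \<le> ennreal C * energy UNIV (wsum a b c t z)" for j :: nat
  proof (induction j)
    case 0
    show ?case
    proof (intro exI[of _ "8 + 2 * 0"] conjI allI)
      fix t z
      show "energy {k. h \<le> residue t k \<and> residue t k < c0 + of_nat 0 * e} z
         \<le> ennreal (8 + 2 * 0) * energy UNIV (wsum a b c t z)"
        by (rule energy_step_bound[where S' = "{}" and s = 0]) (auto intro: jump_eq(3))
    qed auto
  next
    case (Suc j)
    then obtain C where C: "0 \<le> C" "\<And>t z. energy {k. h \<le> residue t k \<and> residue t k < c0 + of_nat j * e} z
      \<le> ennreal C * energy UNIV (wsum a b c t z)" by blast
    show ?case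
    proof (intro exI[of _ "8 + 2 * C"] conjI allI)
      fix t z
      show "energy {k. h \<le> residue t k \<and> residue t k < c0 + of_nat (Suc j) * e} z
         \<le> ennreal (8 + 2 * C) * energy UNIV (wsum a b c t z)"
      proof (rule energy_step_bound[OF C(2) C(1), where s = d])
        fix k assume k: "k \<in> {k. h \<le> residue t k \<and> residue t k < c0 + of_nat (Suc j) * e}"
        show "z k = jump t z k \<or>
          (k + d \<in> {k. h \<le> residue t k \<and> residue t k < c0 + of_nat j * e} \<and> z k = jump t z k + z (k + d))"
        proof (cases "c0 \<le> residue t k")
          case True
          have "residue t (k + d) = residue t k + (- e)"
            using assms True residue_bounds[of t k] c0_lower ab by (intro residue_shift[where u = u]) auto
          then show ?thesis using True k assms by (intro disjI2 conjI jump_eq(2)) (auto simp: algebra_simps)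
        next
          case False
          then show ?thesis using k jump_eq(3)[of t k z] by auto
        qed
      qed
    qed (use C in auto)
  qed
  moreover obtain j :: nat where j: "a < of_nat j * e"
    using reals_Archimedean3[OF assms(1)] by blast
  ultimately obtain C where C: "0 \<le> C" "\<And>t z. energy {k. h \<le> residue t k \<and> residue t k < c0 + of_nat j * e} z
      \<le> ennreal C * energy UNIV (wsum a b c t z)" by blast
  have "residue t k < c0 + of_nat j * e" for t k
    using j residue_bounds(2)[of t k] c0_lower ab by linarith
  then show ?thesis using that[of C] C by simp
qed

text \<open>If the last window containing a point with residue in \<open>D\<close> contains no other
  such point, its value is that window sum minus at most \<open>d\<close> values outside
  \<open>D\<close>. In the constant, 2 comes from splitting the square, one factor \<open>d\<close>
  from Cauchy-Schwarz and one from summing over \<open>d\<close> translates.\<close>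

lemma energy_isolated_bound:
  assumes iso: "\<And>k i. 1 \<le> i \<Longrightarrow> i \<le> d \<Longrightarrow> residue t k \<in> D \<Longrightarrow> residue t (k + i) \<in> D \<Longrightarrow>
      residue t k + of_int i * b < c \<Longrightarrow> False"
  shows "energy {k. residue t k \<in> D} z \<le>
    2 * energy UNIV (wsum a b c t z) + ennreal (2 * (of_int d)\<^sup>2) * energy {k. residue t k \<notin> D} z"
proof -
  let ?f = "\<lambda>m. ennreal ((norm (wsum a b c t z m))\<^sup>2)"
  let ?E = "{k. residue t k \<notin> D}"
  let ?g = "\<lambda>k. ennreal ((norm (z k))\<^sup>2) * indicator ?E k"
  have "energy {k. residue t k \<in> D} z \<le>
      (\<integral>\<^sup>+k. 2 * ?f (cell t k) + ennreal (2 * of_int d) * (\<Sum>i\<in>{1..d}. ?g (k + i)) \<partial>count_space UNIV)"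
    unfolding energy_def
  proof (rule nn_integral_mono)
    fix k
    show "ennreal ((norm (z k))\<^sup>2) * indicator {k. residue t k \<in> D} k \<le>
      2 * ?f (cell t k) + ennreal (2 * of_int d) * (\<Sum>i\<in>{1..d}. ?g (k + i))"
    proof (cases "residue t k \<in> D")
      case True
      \<comment> \<open>The offsets of the other points in the last window of \<open>k\<close>. They
        are all positive, because that window starts less than \<open>a < b\<close> before
        \<open>k\<close>.\<close>
      define Y where "Y = {i. i \<noteq> 0 \<and> k + i \<in> window a b c t (cell t k)}"
      have "i \<in> {1..d} \<and> k + i \<in> ?E" if "i \<in> Y" for i
      proof -
        from that have i: "i \<noteq> 0" "0 \<le> residue t k + of_int i * b" "residue t k + of_int i * b < c"
          by (auto simp: Y_def mem_window_cell)
        have "1 \<le> i" using i int_mult_b(3)[of i] residue_bounds[of t k] ab by linarith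
        moreover have "i \<le> d"
        proof (rule ccontr)
          assume "\<not> i \<le> d"
          \<comment> \<open>An offset beyond \<open>d\<close> would force \<open>b \<le> c0\<close>,
            contrary to \<open>c0 < a < b\<close>.\<close>
          then have "of_int 1 * b \<le> of_int (i - d) * b" using int_mult_b(1)[of "i - d"] by simp
          then show False using i c_eq residue_bounds[of t k] c0_upper ab by (simp add: algebra_simps)
        qed
        ultimately show ?thesis
          using iso[of i k] True i by auto
      qed
      then have Y: "Y \<subseteq> {1..d}" "\<And>i. i \<in> Y \<Longrightarrow> k + i \<in> ?E" by auto
      then have finY: "finite Y" by (meson finite_atLeastAtMost_int finite_subset)
      have "c > a" using c_eq int_mult_b(1)[OF d1] ab c0_lower by linarith
      then have "k \<in> window a b c t (cell t k)"
        using residue_bounds[of t k] by (simp add: mem_window_cell)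
      then have "window a b c t (cell t k) = insert k ((+) k ` Y)"
      proof -
        have "j \<in> (+) k ` Y" if "j \<in> window a b c t (cell t k)" "j \<noteq> k" for j
          by (rule image_eqI[of _ _ "j - k"]) (use that in \<open>auto simp: Y_def\<close>)
        then show ?thesis using \<open>k \<in> window a b c t (cell t k)\<close> by (auto simp: Y_def)
      qed
      moreover have "k \<notin> (+) k ` Y" by (auto simp: Y_def)
      ultimately have "wsum a b c t z (cell t k) = z k + sum z ((+) k ` Y)"
        using finY by (simp add: wsum_def)
      also have "sum z ((+) k ` Y) = (\<Sum>i\<in>Y. z (k + i))"
        by (simp add: sum.reindex)
      finally have zk: "z k = wsum a b c t z (cell t k) + - (\<Sum>i\<in>Y. z (k + i))" by simp
      have "(norm (z k))\<^sup>2 \<le> 2 * (norm (wsum a b c t z (cell t k)))\<^sup>2 + 2 * (norm (\<Sum>i\<in>Y. z (k + i)))\<^sup>2"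
        by (subst zk) (metis norm_add_sq_le norm_minus_cancel)
      also have "(norm (\<Sum>i\<in>Y. z (k + i)))\<^sup>2 \<le> of_nat (card Y) * (\<Sum>i\<in>Y. (norm (z (k + i)))\<^sup>2)"
        by (rule norm_sum_sq_le)
      also have "\<dots> \<le> of_int d * (\<Sum>i\<in>{1..d}. (norm (z (k + i)))\<^sup>2 * indicator ?E (k + i))"
      proof (rule mult_mono)
        have "card Y \<le> card {1..d}" by (rule card_mono[OF _ Y(1)]) simp
        then show "real (card Y) \<le> of_int d" using d1 by simp
        show "(\<Sum>i\<in>Y. (norm (z (k + i)))\<^sup>2) \<le> (\<Sum>i\<in>{1..d}. (norm (z (k + i)))\<^sup>2 * indicator ?E (k + i))"
        proof -
          have "(\<Sum>i\<in>Y. (norm (z (k + i)))\<^sup>2) = (\<Sum>i\<in>Y. (norm (z (k + i)))\<^sup>2 * indicator ?E (k + i))"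
            by (rule sum.cong) (use Y(2) in auto)
          also have "\<dots> \<le> (\<Sum>i\<in>{1..d}. (norm (z (k + i)))\<^sup>2 * indicator ?E (k + i))"
            by (rule sum_mono2) (use Y(1) in auto)
          finally show ?thesis .
        qed
      qed (use d1 in \<open>auto intro: sum_nonneg\<close>)
      finally have "(norm (z k))\<^sup>2 \<le> 2 * (norm (wsum a b c t z (cell t k)))\<^sup>2
          + (2 * of_int d) * (\<Sum>i\<in>{1..d}. (norm (z (k + i)))\<^sup>2 * indicator ?E (k + i))"
        by (simp add: mult.assoc)
      then have "ennreal ((norm (z k))\<^sup>2) \<le> ennreal (2 * (norm (wsum a b c t z (cell t k)))\<^sup>2
          + (2 * of_int d) * (\<Sum>i\<in>{1..d}. (norm (z (k + i)))\<^sup>2 * indicator ?E (k + i)))"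
        by (rule ennreal_leI)
      also have "\<dots> = ennreal (2 * (norm (wsum a b c t z (cell t k)))\<^sup>2)
          + ennreal (2 * of_int d) * ennreal (\<Sum>i\<in>{1..d}. (norm (z (k + i)))\<^sup>2 * indicator ?E (k + i))"
      proof -
        have "0 \<le> (\<Sum>i\<in>{1..d}. (norm (z (k + i)))\<^sup>2 * indicator ?E (k + i))"
          by (intro sum_nonneg) auto
        then show ?thesis using d1 by (subst ennreal_plus) (simp_all add: ennreal_mult del: sum_mult_indicator)
      qed
      also have "ennreal (\<Sum>i\<in>{1..d}. (norm (z (k + i)))\<^sup>2 * indicator ?E (k + i)) = (\<Sum>i\<in>{1..d}. ?g (k + i))"
        by (subst sum_ennreal[symmetric]) (auto intro!: sum.cong simp: indicator_def)
      also have "ennreal (2 * (norm (wsum a b c t z (cell t k)))\<^sup>2) = 2 * ?f (cell t k)"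
        by (simp add: ennreal_mult')
      finally show ?thesis using True by simp
    qed simp
  qed
  also have "\<dots> = 2 * (\<integral>\<^sup>+k. ?f (cell t k) \<partial>count_space UNIV) +
      ennreal (2 * of_int d) * (\<Sum>i\<in>{1..d}. \<integral>\<^sup>+k. ?g (k + i) \<partial>count_space UNIV)"
    by (subst nn_integral_add; (subst nn_integral_cmult)?; (subst nn_integral_cmult)?; (subst nn_integral_sum)?) simp_all
  also have "(\<Sum>i\<in>{1..d}. \<integral>\<^sup>+k. ?g (k + i) \<partial>count_space UNIV) = (\<Sum>i\<in>{1..d}. energy ?E z)"
    unfolding energy_def by (intro sum.cong refl nn_integral_count_space_shift)
  also have "\<dots> = ennreal (of_int d) * energy ?E z"
    using d1 by (simp add: ennreal_of_nat_eq_real_of_nat)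
  also have "ennreal (2 * of_int d) * (ennreal (of_int d) * energy ?E z) = ennreal (2 * (of_int d)\<^sup>2) * energy ?E z"
    using d1 by (simp add: ennreal_mult'[symmetric] power2_eq_square mult.assoc[symmetric])
  also have "(\<integral>\<^sup>+k. ?f (cell t k) \<partial>count_space UNIV) \<le> energy UNIV (wsum a b c t z)"
    unfolding energy_def using nn_integral_count_space_inj_le[OF inj_cell, of ?f t] by simp
  finally show ?thesis by (simp add: add_mono mult_left_mono)
qed

text \<open>Both sides drift into the hole. As the two displacements are positive and add up to the
  hole length, neither exceeds it; the two controlled regions overlap in the hole and cover all
  residues.\<close>

lemma stable_left_right:
  assumes "0 < e" "0 < e'" "e + e' = b - a"
    "of_int (d + 1) * b = e + of_int u * a" "of_int d * b = - e' + of_int u' * a"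
  shows "\<exists>C\<ge>0. \<forall>t z. energy UNIV z \<le> ennreal C * energy UNIV (wsum a b c t z)"
proof -
  obtain C where C: "0 \<le> C" "\<And>t z. energy {k. residue t k < c0} z \<le> ennreal C * energy UNIV (wsum a b c t z)"
    using energy_left_bound[of e u] assms by auto
  obtain C' where C': "0 \<le> C'" "\<And>t z. energy {k. h \<le> residue t k} z \<le> ennreal C' * energy UNIV (wsum a b c t z)"
    using energy_right_bound[of e' u'] assms by auto
  show ?thesis
  proof (intro exI[of _ "C + C'"] conjI allI)
    fix t z
    have "energy UNIV z \<le> energy ({k. residue t k < c0} \<union> {k. h \<le> residue t k}) z"
      using ab by (intro energy_mono) auto
    also have "\<dots> \<le> energy {k. residue t k < c0} z + energy {k. h \<le> residue t k} z"
      by (rule energy_Un_le)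
    also have "\<dots> \<le> ennreal C * energy UNIV (wsum a b c t z) + ennreal C' * energy UNIV (wsum a b c t z)"
      by (intro add_mono C C')
    also have "\<dots> = ennreal (C + C') * energy UNIV (wsum a b c t z)"
      using C C' by (simp add: distrib_right)
    finally show "energy UNIV z \<le> ennreal (C + C') * energy UNIV (wsum a b c t z)" .
  qed (use C C' in auto)
qed

text \<open>Control outside \<open>D\<close> is extended to \<open>D\<close> through single windows,
  without any drift.\<close>

lemma stable_isolated:
  assumes C: "0 \<le> C" "\<And>t z. energy {k. residue t k \<notin> D} z \<le> ennreal C * energy UNIV (wsum a b c t z)"
    and iso: "\<And>t k i. 1 \<le> i \<Longrightarrow> i \<le> d \<Longrightarrow> residue t k \<in> D \<Longrightarrow> residue t (k + i) \<in> D \<Longrightarrow>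
      residue t k + of_int i * b < c \<Longrightarrow> False"
  shows "\<exists>C\<ge>0. \<forall>t z. energy UNIV z \<le> ennreal C * energy UNIV (wsum a b c t z)"
proof (intro exI[of _ "2 + (2 * (of_int d)\<^sup>2 + 1) * C"] conjI allI)
  fix t z
  let ?W = "energy UNIV (wsum a b c t z)"
  have "energy UNIV z \<le> energy ({k. residue t k \<in> D} \<union> {k. residue t k \<notin> D}) z"
    by (intro energy_mono) auto
  also have "\<dots> \<le> energy {k. residue t k \<in> D} z + energy {k. residue t k \<notin> D} z"
    by (rule energy_Un_le)
  also have "\<dots> \<le> (2 * ?W + ennreal (2 * (of_int d)\<^sup>2) * energy {k. residue t k \<notin> D} z) + energy {k. residue t k \<notin> D} z"
    by (intro add_right_mono energy_isolated_bound iso)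
  also have "\<dots> \<le> (2 * ?W + ennreal (2 * (of_int d)\<^sup>2) * (ennreal C * ?W)) + ennreal C * ?W"
    by (intro add_mono mult_left_mono C(2) order_refl) auto
  also have "\<dots> = (ennreal 2 + ennreal (2 * (of_int d)\<^sup>2) * ennreal C + ennreal C) * ?W"
    by (simp add: distrib_right mult.assoc)
  also have "ennreal 2 + ennreal (2 * (of_int d)\<^sup>2) * ennreal C + ennreal C = ennreal (2 + (2 * (of_int d)\<^sup>2 + 1) * C)"
    using C(1) by (simp add: ennreal_mult'[symmetric] distrib_right ennreal_plus[symmetric] add.assoc del: ennreal_plus ennreal_numeral)
  finally show "energy UNIV z \<le> ennreal (2 + (2 * (of_int d)\<^sup>2 + 1) * C) * ?W" .
qed (use C in auto)

end

section \<open>From window sums to Gabor frames\<close>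

lemma mem_period_cell_iff:
  fixes b x :: real
  assumes "0 < b"
  shows "x \<in> {of_int k * b..<(of_int k + 1) * b} \<longleftrightarrow> k = \<lfloor>x / b\<rfloor>"
  unfolding eq_commute[of k] floor_eq_iff using assms by (simp add: pos_le_divide_eq pos_divide_less_eq)

lemma borel_measurable_nn_integral_count_space_int:
  fixes g :: "int \<Rightarrow> 'a \<Rightarrow> ennreal"
  assumes [measurable]: "\<And>k. g k \<in> borel_measurable M"
  shows "(\<lambda>t. \<integral>\<^sup>+k. g k t \<partial>count_space UNIV) \<in> borel_measurable M"
proof -
  have "(\<integral>\<^sup>+k. g k t \<partial>count_space UNIV) = (\<Sum>n. g (int_decode n) t)" for t
    by (subst nn_integral_count_space_nat[symmetric])
      (rule nn_integral_bij_count_space[symmetric, of int_decode UNIV UNIV "\<lambda>k. g k t"], rule bij_int_decode)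
  then show ?thesis by simp
qed

lemma borel_measurable_energy:
  assumes [measurable]: "\<And>k. (\<lambda>t. z t k) \<in> borel_measurable M"
  shows "(\<lambda>t. energy S (z t)) \<in> borel_measurable M"
  unfolding energy_def by (rule borel_measurable_nn_integral_count_space_int) measurable

lemma nn_integral_periodize:
  assumes g [measurable]: "g \<in> borel_measurable borel" and b: "0 < b"
  shows "(\<integral>\<^sup>+x. g x \<partial>lborel) = (\<integral>\<^sup>+t. (\<integral>\<^sup>+k. g (t + of_int k * b) \<partial>count_space (UNIV :: int set)) \<partial>period b)"
proof -
  let ?I = "\<lambda>k :: int. {of_int k * b..<(of_int k + 1) * b}"
  have "g x = (\<integral>\<^sup>+k. g x * indicator (?I k) x \<partial>count_space UNIV)" for x
  proof -
    have *: "x \<in> ?I k \<longleftrightarrow> k = \<lfloor>x / b\<rfloor>" for k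
      by (rule mem_period_cell_iff[OF b])
    have "(\<integral>\<^sup>+k. g x * indicator (?I k) x \<partial>count_space UNIV) = (\<Sum>k\<in>{\<lfloor>x / b\<rfloor>}. g x * indicator (?I k) x)"
      by (rule nn_integral_count_space') (use * in \<open>auto simp: indicator_def\<close>)
    also have "\<dots> = g x" using *[of "\<lfloor>x / b\<rfloor>"] by (simp add: indicator_def)
    finally show ?thesis by simp
  qed
  then have "(\<integral>\<^sup>+x. g x \<partial>lborel) = (\<integral>\<^sup>+x. (\<integral>\<^sup>+k. g x * indicator (?I k) x \<partial>count_space UNIV) \<partial>lborel)"
    by simp
  also have "\<dots> = (\<integral>\<^sup>+k. (\<integral>\<^sup>+x. g x * indicator (?I k) x \<partial>lborel) \<partial>count_space UNIV)"
    by (rule nn_integral_count_space_nn_integral) auto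
  also have "\<dots> = (\<integral>\<^sup>+k. (\<integral>\<^sup>+t. g (t + of_int k * b) \<partial>period b) \<partial>count_space UNIV)"
  proof (rule nn_integral_cong)
    fix k :: int
    have "(\<integral>\<^sup>+x. g x * indicator (?I k) x \<partial>lborel) = (\<integral>\<^sup>+x. g (of_int k * b + 1 * x) * indicator (?I k) (of_int k * b + 1 * x) \<partial>lborel)"
      by (subst nn_integral_real_affine[where c = 1 and t = "of_int k * b"]) auto
    also have "\<dots> = (\<integral>\<^sup>+x. g (x + of_int k * b) * indicator {0..<b} x \<partial>lborel)"
      by (intro nn_integral_cong) (auto simp: indicator_def algebra_simps)
    also have "\<dots> = (\<integral>\<^sup>+t. g (t + of_int k * b) \<partial>period b)"
      by (simp add: nn_integral_restrict_space)
    finally show "(\<integral>\<^sup>+x. g x * indicator (?I k) x \<partial>lborel) = (\<integral>\<^sup>+t. g (t + of_int k * b) \<partial>period b)" .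
  qed
  also have "\<dots> = (\<integral>\<^sup>+t. (\<integral>\<^sup>+k. g (t + of_int k * b) \<partial>count_space UNIV) \<partial>period b)"
    by (rule nn_integral_count_space_nn_integral[symmetric]) (auto intro: measurable_period)
  finally show ?thesis .
qed

text \<open>The Bochner counterpart for functions supported in finitely many periods: the sum over
  periods is finite, so it may be interchanged with the integral.\<close>

lemma integral_periodize_finite:
  fixes G :: "real \<Rightarrow> complex"
  assumes G: "integrable lborel G" and K: "finite K" and b: "0 < b"
    and supp: "\<And>x. G x \<noteq> 0 \<Longrightarrow> \<lfloor>x / b\<rfloor> \<in> K"
  shows "(LINT x|lborel. G x) = (LINT t|period b. (\<Sum>k\<in>K. G (t + of_int k * b)))"
proof -
  let ?I = "\<lambda>k :: int. {of_int k * b..<(of_int k + 1) * b}"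
  note mem = mem_period_cell_iff[OF b]
  have [measurable]: "G \<in> borel_measurable borel" using G by auto
  have sh: "integrable lborel (\<lambda>x. G (x + of_int k * b))" for k :: int
    using lborel_integrable_real_affine[OF G, of 1 "of_int k * b"] by (simp add: add.commute)
  have "G x = (\<Sum>k\<in>K. indicator (?I k) x *\<^sub>R G x)" for x
  proof (cases "G x = 0")
    case False
    have "(\<Sum>k\<in>K. indicator (?I k) x *\<^sub>R G x) = (\<Sum>k\<in>K. if k = \<lfloor>x / b\<rfloor> then G x else 0)"
      by (rule sum.cong) (auto simp: indicator_def mem[unfolded atLeastLessThan_iff])
    then show ?thesis using K supp[OF False] by simp
  qed simp
  then have "(LINT x|lborel. G x) = (LINT x|lborel. (\<Sum>k\<in>K. indicator (?I k) x *\<^sub>R G x))"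
    by presburger
  also have "\<dots> = (\<Sum>k\<in>K. (LINT x|lborel. indicator (?I k) x *\<^sub>R G x))"
    using G by (intro Bochner_Integration.integral_sum integrable_mult_indicator) auto
  also have "\<dots> = (\<Sum>k\<in>K. (LINT t|period b. G (t + of_int k * b)))"
  proof (rule sum.cong[OF refl])
    fix k
    have "(LINT x|lborel. indicator (?I k) x *\<^sub>R G x) =
        (LINT x|lborel. indicator (?I k) (of_int k * b + 1 * x) *\<^sub>R G (of_int k * b + 1 * x))"
      by (subst lborel_integral_real_affine[where c = 1 and t = "of_int k * b"]) auto
    also have "\<dots> = (LINT x|lborel. indicator {0..<b} x *\<^sub>R G (x + of_int k * b))"
      by (intro Bochner_Integration.integral_cong) (auto simp: indicator_def algebra_simps)
    also have "\<dots> = (LINT t|period b. G (t + of_int k * b))"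
      by (simp add: integral_restrict_space)
    finally show "(LINT x|lborel. indicator (?I k) x *\<^sub>R G x) = (LINT t|period b. G (t + of_int k * b))" .
  qed
  also have "\<dots> = (LINT t|period b. (\<Sum>k\<in>K. G (t + of_int k * b)))"
    by (rule Bochner_Integration.integral_sum[symmetric])
      (auto simp: integrable_restrict_space set_integrable_def intro!: integrable_mult_indicator sh)
  finally show ?thesis .
qed

definition fibre :: "real \<Rightarrow> (real \<Rightarrow> complex) \<Rightarrow> real \<Rightarrow> int \<Rightarrow> complex" where
  "fibre b f t k = f (t + of_int k * b)"

lemma energy_fibre:
  assumes f: "square_integrable f" and b: "0 < b"
  shows "(\<integral>\<^sup>+t. energy UNIV (fibre b f t) \<partial>period b) = ennreal (l2_norm_sq f)"
proof -
  have [measurable]: "f \<in> borel_measurable borel" and int: "integrable lborel (\<lambda>t. (norm (f t))\<^sup>2)"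
    using f by (auto simp: square_integrable_def)
  have "(\<integral>\<^sup>+t. energy UNIV (fibre b f t) \<partial>period b) = (\<integral>\<^sup>+x. ennreal ((norm (f x))\<^sup>2) \<partial>lborel)"
    unfolding energy_def fibre_def by (subst nn_integral_periodize[OF _ b]) auto
  also have "\<dots> = ennreal (l2_norm_sq f)"
    unfolding l2_norm_sq_def by (rule nn_integral_eq_integral[OF int]) simp
  finally show ?thesis .
qed

text \<open>A window depends on \<open>t\<close>, but for \<open>t\<close> in one period it stays
  inside a fixed finite set \<open>K\<close>. This gives measurability in \<open>t\<close> and
  permits termwise integration.\<close>

lemma wsum_fibre_eq:
  fixes a b c :: real and m :: int
  assumes b: "0 < b" and t: "t \<in> {0..<b}"
  defines "K \<equiv> {\<lfloor>of_int m * a / b\<rfloor>..\<lfloor>(of_int m * a + c) / b\<rfloor>}"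
  shows "wsum a b c t z m = (\<Sum>k\<in>K. z k * indicator {of_int m * a..<of_int m * a + c} (t + of_int k * b))"
proof -
  have mem: "k \<in> window a b c t m \<longleftrightarrow> t + of_int k * b \<in> {of_int m * a..<of_int m * a + c}" for k
    by (auto simp: window_def)
  have "k \<in> K" if "k \<in> window a b c t m" for k
  proof -
    have "\<lfloor>(t + of_int k * b) / b\<rfloor> = k"
      using t b by (intro floor_unique) (auto simp: field_simps)
    moreover have "\<lfloor>of_int m * a / b\<rfloor> \<le> \<lfloor>(t + of_int k * b) / b\<rfloor>"
      using that b unfolding mem by (intro floor_mono divide_right_mono) auto
    moreover have "\<lfloor>(t + of_int k * b) / b\<rfloor> \<le> \<lfloor>(of_int m * a + c) / b\<rfloor>"
      using that b unfolding mem by (intro floor_mono divide_right_mono) auto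
    ultimately show ?thesis by (simp add: K_def)
  qed
  then have "window a b c t m \<subseteq> K" by auto
  then show ?thesis unfolding wsum_def
    by (intro sum.mono_neutral_cong_left) (auto simp: K_def mem)
qed

lemma measurable_wsum_fibre:
  assumes [measurable]: "f \<in> borel_measurable borel" and b: "0 < b"
  shows "(\<lambda>t. wsum a b c t (fibre b f t) m) \<in> borel_measurable (period b)"
proof -
  let ?K = "{\<lfloor>of_int m * a / b\<rfloor>..\<lfloor>(of_int m * a + c) / b\<rfloor>}"
  have "(\<lambda>t. \<Sum>k\<in>?K. fibre b f t k * indicator {of_int m * a..<of_int m * a + c} (t + of_int k * b))
      \<in> borel_measurable (period b)"
    unfolding fibre_def by (rule measurable_period) measurable
  then show ?thesis
    by (rule measurable_cong[THEN iffD2, rotated]) (use wsum_fibre_eq[OF b] in simp)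
qed

text \<open>The modulation is \<open>b\<close>-periodic, so folding the line onto one period leaves
  it outside the sum over the window: the coefficient is a Fourier coefficient of the
  \<open>m\<close>-th window sum.\<close>

lemma l2_inner_gabor_atom:
  assumes f: "square_integrable f" and b: "0 < b" and c: "0 < c"
  shows "l2_inner f (gabor_atom (indicator {0..<c}) a b m n) =
    (LINT t|period b. wsum a b c t (fibre b f t) m * fmode b n t)"
proof -
  let ?K = "{\<lfloor>of_int m * a / b\<rfloor>..\<lfloor>(of_int m * a + c) / b\<rfloor>}"
  let ?J = "{of_int m * a..<of_int m * a + c}"
  define G where "G = (\<lambda>x. f x * fmode b n x * indicator ?J x)"
  have [measurable]: "f \<in> borel_measurable borel" and int: "integrable lborel (\<lambda>t. (norm (f t))\<^sup>2)"
    using f by (auto simp: square_integrable_def)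
  have "cnj (gabor_atom (indicator {0..<c}) a b m n x) = fmode b n x * indicator ?J x" for x
  proof -
    have "exp (- 2 * pi * \<i> * of_int n * of_real x / of_real b) = fmode b (- n) x"
      by (simp add: fmode_def cis_conv_exp mult_ac)
    moreover have "(indicator {0..<c} (x - of_int m * a) :: complex) = indicator ?J x"
      by (auto simp: indicator_def)
    moreover have "cnj (indicator ?J x) = (indicator ?J x :: complex)" by (simp add: indicator_def)
    ultimately show ?thesis by (simp add: gabor_atom_def cnj_fmode)
  qed
  then have "l2_inner f (gabor_atom (indicator {0..<c}) a b m n) = (LINT x|lborel. G x)"
    by (simp add: l2_inner_def G_def mult.assoc)
  also have "\<dots> = (LINT t|period b. (\<Sum>k\<in>?K. G (t + of_int k * b)))"
  proof (rule integral_periodize_finite[OF _ _ b])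
    show "integrable lborel G"
    proof (rule Bochner_Integration.integrable_bound)
      \<comment> \<open>On the bounded interval carrying \<open>G\<close>, the modulus of
        \<open>f\<close> is at most its square plus 1, so square integrability suffices.\<close>
      show "integrable lborel (\<lambda>x. (norm (f x))\<^sup>2 + indicator ?J x)"
        using int c by (intro Bochner_Integration.integrable_add integrable_real_indicator) auto
      show "AE x in lborel. norm (G x) \<le> norm ((norm (f x))\<^sup>2 + indicator ?J x)"
      proof (rule AE_I2)
        fix x
        have "0 \<le> (norm (f x) - 1/2)\<^sup>2" by simp
        then have "norm (f x) \<le> (norm (f x))\<^sup>2 + 1"
          by (simp add: power2_eq_square algebra_simps)
        then show "norm (G x) \<le> norm ((norm (f x))\<^sup>2 + indicator ?J x)"
          by (simp add: G_def norm_mult indicator_def)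
      qed
    qed (unfold G_def, measurable)
    fix x assume "G x \<noteq> 0"
    then have "x \<in> ?J" by (auto simp: G_def indicator_def split: if_splits)
    then show "\<lfloor>x / b\<rfloor> \<in> ?K"
      using b by (auto intro!: floor_mono divide_right_mono)
  qed simp
  also have "\<dots> = (LINT t|period b. wsum a b c t (fibre b f t) m * fmode b n t)"
  proof (rule Bochner_Integration.integral_cong[OF refl])
    fix t assume "t \<in> space (period b)"
    then have t: "t \<in> {0..<b}" by simp
    show "(\<Sum>k\<in>?K. G (t + of_int k * b)) = wsum a b c t (fibre b f t) m * fmode b n t"
      unfolding wsum_fibre_eq[OF b t] sum_distrib_right G_def fibre_def
      by (intro sum.cong refl) (use b in \<open>simp add: fmode_shift\<close>)
  qed
  finally show ?thesis .
qed

text \<open>Parseval over \<open>n\<close> for each fixed \<open>m\<close>, followed by Tonelli over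
  \<open>m\<close>. The preliminary bound \<open>fin\<close> by the energy of the fibre supplies the
  square integrability that Parseval requires.\<close>

lemma gabor_coefficients_energy:
  assumes f: "square_integrable f" and a: "0 < a" and b: "0 < b" and c: "0 < c"
  shows "(\<integral>\<^sup>+(m, n). ennreal ((norm (l2_inner f (gabor_atom (indicator {0..<c}) a b m n)))\<^sup>2) \<partial>count_space UNIV)
    = ennreal b * (\<integral>\<^sup>+t. energy UNIV (wsum a b c t (fibre b f t)) \<partial>period b)"
proof -
  have [measurable]: "f \<in> borel_measurable borel" using f by (auto simp: square_integrable_def)
  let ?F = "\<lambda>m t. wsum a b c t (fibre b f t) m"
  have F [measurable]: "?F m \<in> borel_measurable (period b)" for m
    by (rule measurable_wsum_fibre[OF _ b]) measurable
  have fin: "(\<integral>\<^sup>+t. ennreal ((norm (?F m t))\<^sup>2) \<partial>period b) < \<infinity>" for m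
  proof -
    let ?C = "ennreal (real (nat (\<lceil>c / b\<rceil> + 1)) * real (nat (\<lceil>c / a\<rceil> + 1)))"
    have "(\<integral>\<^sup>+t. ennreal ((norm (?F m t))\<^sup>2) \<partial>period b) \<le> (\<integral>\<^sup>+t. ?C * energy UNIV (fibre b f t) \<partial>period b)"
    proof (rule nn_integral_mono)
      fix t
      have "ennreal ((norm (?F m t))\<^sup>2) \<le> energy UNIV (wsum a b c t (fibre b f t))"
        using sum_le_nn_integral_count_space[of "{m}" "\<lambda>m. ennreal ((norm (?F m t))\<^sup>2)"]
        by (simp add: energy_def)
      also have "\<dots> \<le> ?C * energy UNIV (fibre b f t)" by (rule energy_wsum_le[OF a b])
      finally show "ennreal ((norm (?F m t))\<^sup>2) \<le> ?C * energy UNIV (fibre b f t)" .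
    qed
    also have "\<dots> = ?C * (\<integral>\<^sup>+t. energy UNIV (fibre b f t) \<partial>period b)"
    proof (rule nn_integral_cmult)
      show "(\<lambda>t. energy UNIV (fibre b f t)) \<in> borel_measurable (period b)"
        unfolding fibre_def by (intro borel_measurable_energy measurable_period) measurable
    qed
    also have "\<dots> < \<infinity>" unfolding energy_fibre[OF f b] by (simp add: ennreal_mult_less_top)
    finally show ?thesis .
  qed
  have "(\<integral>\<^sup>+(m, n). ennreal ((norm (l2_inner f (gabor_atom (indicator {0..<c}) a b m n)))\<^sup>2) \<partial>count_space UNIV)
     = (\<integral>\<^sup>+m. \<integral>\<^sup>+n. ennreal ((norm (l2_inner f (gabor_atom (indicator {0..<c}) a b m n)))\<^sup>2) \<partial>count_space UNIV \<partial>count_space UNIV)"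
    by (simp add: nn_integral_fst_count_space[symmetric])
  also have "\<dots> = (\<integral>\<^sup>+m. ennreal b * (\<integral>\<^sup>+t. ennreal ((norm (?F m t))\<^sup>2) \<partial>period b) \<partial>count_space UNIV)"
    unfolding l2_inner_gabor_atom[OF f b c] parseval_period[OF F fin b] ..
  also have "\<dots> = ennreal b * (\<integral>\<^sup>+m. (\<integral>\<^sup>+t. ennreal ((norm (?F m t))\<^sup>2) \<partial>period b) \<partial>count_space UNIV)"
    by (rule nn_integral_cmult) simp
  also have "(\<integral>\<^sup>+m. (\<integral>\<^sup>+t. ennreal ((norm (?F m t))\<^sup>2) \<partial>period b) \<partial>count_space UNIV)
      = (\<integral>\<^sup>+t. (\<integral>\<^sup>+m. ennreal ((norm (?F m t))\<^sup>2) \<partial>count_space UNIV) \<partial>period b)"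
    by (rule nn_integral_count_space_nn_integral[symmetric]) auto
  finally show ?thesis by (simp add: energy_def)
qed

section \<open>The frame property as a lower bound on fibres\<close>

lemma nn_integral_count_space_infsum:
  fixes u :: "'i \<Rightarrow> real"
  assumes u: "\<And>x. 0 \<le> u x"
  shows "(\<integral>\<^sup>+x. ennreal (u x) \<partial>count_space UNIV) < \<infinity> \<longleftrightarrow> u summable_on UNIV"
    and "u summable_on UNIV \<Longrightarrow> (\<integral>\<^sup>+x. ennreal (u x) \<partial>count_space UNIV) = ennreal (infsum u UNIV)"
proof -
  have abs: "u summable_on UNIV \<longleftrightarrow> Infinite_Set_Sum.abs_summable_on u UNIV"
    using abs_summable_equivalent[of u UNIV] u by simp
  show eq: "(\<integral>\<^sup>+x. ennreal (u x) \<partial>count_space UNIV) = ennreal (infsum u UNIV)" if "u summable_on UNIV"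
    using that u by (simp add: abs nn_integral_conv_infsetsum infsetsum_infsum)
  show "(\<integral>\<^sup>+x. ennreal (u x) \<partial>count_space UNIV) < \<infinity> \<longleftrightarrow> u summable_on UNIV"
  proof
    assume "(\<integral>\<^sup>+x. ennreal (u x) \<partial>count_space UNIV) < \<infinity>"
    then have "integrable (count_space UNIV) u"
      using u by (intro integrableI_bounded) auto
    then show "u summable_on UNIV" by (simp add: abs abs_summable_on_def)
  qed (simp add: eq)
qed

text \<open>Summability and the upper frame bound always hold by \<open>energy_wsum_le\<close>, so
  only the lower bound is at stake. The two lower constants differ by the factor \<open>b\<close>
  from Parseval.\<close>

lemma gabor_frame_iff:
  assumes a: "0 < a" and b: "0 < b" and c: "0 < c"
  shows "gabor_frame (indicator {0..<c}) a b \<longleftrightarrow>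
    (\<exists>A>0. \<forall>f. square_integrable f \<longrightarrow>
      ennreal A * ennreal (l2_norm_sq f) \<le> (\<integral>\<^sup>+t. energy UNIV (wsum a b c t (fibre b f t)) \<partial>period b))"
    (is "?L \<longleftrightarrow> ?R")
proof
  let ?u = "\<lambda>f. \<lambda>(m, n). (norm (l2_inner f (gabor_atom (indicator {0..<c}) a b m n)))\<^sup>2"
  let ?T = "\<lambda>f. \<integral>\<^sup>+t. energy UNIV (wsum a b c t (fibre b f t)) \<partial>period b"
  have coef: "(\<integral>\<^sup>+x. ennreal (?u f x) \<partial>count_space UNIV) = ennreal b * ?T f" if "square_integrable f" for f
    using gabor_coefficients_energy[OF that a b c] by (simp add: case_prod_beta')
  have u0: "0 \<le> ?u f x" for f x by (simp add: case_prod_beta')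
  have N0: "0 \<le> l2_norm_sq f" for f by (simp add: l2_norm_sq_def)
  {
    assume ?L
    then obtain A B where A: "0 < A" and fr: "\<And>f. square_integrable f \<Longrightarrow> ?u f summable_on UNIV \<and> A * l2_norm_sq f \<le> infsum (?u f) UNIV"
      unfolding gabor_frame_def by blast
    show ?R
    proof (intro exI[of _ "A / b"] conjI allI impI)
      fix f assume f: "square_integrable f"
      have "ennreal (A * l2_norm_sq f) \<le> ennreal (infsum (?u f) UNIV)"
        using fr[OF f] by (simp add: ennreal_leI)
      also have "\<dots> = ennreal b * ?T f"
        using nn_integral_count_space_infsum(2)[of "?u f", OF u0] fr[OF f] coef[OF f] by simp
      finally have "ennreal (1 / b) * ennreal (A * l2_norm_sq f) \<le> ennreal (1 / b) * (ennreal b * ?T f)"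
        by (rule mult_left_mono) simp
      also have "\<dots> = ?T f" using b by (simp add: mult.assoc[symmetric] ennreal_mult''[symmetric])
      finally show "ennreal (A / b) * ennreal (l2_norm_sq f) \<le> ?T f"
        using A b N0 by (simp add: ennreal_mult'[symmetric])
    qed (use A b in simp)
  }
  {
    assume ?R
    then obtain A where A: "0 < A" and lower: "\<And>f. square_integrable f \<Longrightarrow> ennreal A * ennreal (l2_norm_sq f) \<le> ?T f"
      by blast
    define K where "K = real (nat (\<lceil>c / b\<rceil> + 1)) * real (nat (\<lceil>c / a\<rceil> + 1))"
    have K0: "0 \<le> K" by (simp add: K_def)
    show ?L unfolding gabor_frame_def
    \<comment> \<open>The true upper constant is \<open>b * K\<close>; adding \<open>A\<close>
      guarantees that the lower bound does not exceed the upper one.\<close>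
    proof (rule exI[of _ "b * A"], rule exI[of _ "b * (A + K)"], intro conjI allI impI)
      show "0 < b * A" using A b by simp
      show "b * A \<le> b * (A + K)" using K0 b by simp
      fix f assume f: "square_integrable f"
      have [measurable]: "f \<in> borel_measurable borel" using f by (auto simp: square_integrable_def)
      have "?T f \<le> (\<integral>\<^sup>+t. ennreal K * energy UNIV (fibre b f t) \<partial>period b)"
        unfolding K_def by (intro nn_integral_mono energy_wsum_le a b)
      also have "\<dots> = ennreal K * (\<integral>\<^sup>+t. energy UNIV (fibre b f t) \<partial>period b)"
      proof (rule nn_integral_cmult)
        show "(\<lambda>t. energy UNIV (fibre b f t)) \<in> borel_measurable (period b)"
          unfolding fibre_def by (intro borel_measurable_energy measurable_period) measurable
      qed
      finally have upper: "?T f \<le> ennreal K * ennreal (l2_norm_sq f)" unfolding energy_fibre[OF f b] .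
      have "(\<integral>\<^sup>+x. ennreal (?u f x) \<partial>count_space UNIV) \<le> ennreal b * (ennreal K * ennreal (l2_norm_sq f))"
        unfolding coef[OF f] by (intro mult_left_mono upper) simp
      also have "\<dots> = ennreal (b * K * l2_norm_sq f)"
        using b K0 N0 by (simp add: ennreal_mult'[symmetric] mult.assoc)
      finally have up: "(\<integral>\<^sup>+x. ennreal (?u f x) \<partial>count_space UNIV) \<le> ennreal (b * K * l2_norm_sq f)" .
      then have "(\<integral>\<^sup>+x. ennreal (?u f x) \<partial>count_space UNIV) < \<infinity>"
        using ennreal_less_top le_less_trans by fastforce
      then show sm: "?u f summable_on UNIV"
        using nn_integral_count_space_infsum(1)[of "?u f", OF u0] by blast
      note eq = nn_integral_count_space_infsum(2)[of "?u f", OF u0 sm]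
      have i0: "0 \<le> infsum (?u f) UNIV" by (rule infsum_nonneg) (rule u0)
      have "infsum (?u f) UNIV \<le> b * K * l2_norm_sq f"
        using up unfolding eq using b K0 N0 by (simp add: ennreal_le_iff)
      also have "\<dots> \<le> b * (A + K) * l2_norm_sq f"
        using A b K0 N0 by (intro mult_right_mono mult_left_mono) auto
      finally show "infsum (?u f) UNIV \<le> b * (A + K) * l2_norm_sq f" .
      have "ennreal (b * A * l2_norm_sq f) = ennreal b * (ennreal A * ennreal (l2_norm_sq f))"
        using b A N0 by (simp add: ennreal_mult'[symmetric] mult.assoc)
      also have "\<dots> \<le> ennreal b * ?T f" by (intro mult_left_mono lower[OF f]) simp
      also have "\<dots> = ennreal (infsum (?u f) UNIV)" using coef[OF f] eq by simp
      finally show "b * A * l2_norm_sq f \<le> infsum (?u f) UNIV" using i0 by (simp add: ennreal_le_iff)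
    qed
  }
qed

text \<open>An estimate with a constant independent of the base point integrates to the lower frame
  bound. \<open>C + 1\<close> replaces \<open>C\<close> to permit division.\<close>

lemma gabor_frame_of_stable:
  assumes a: "0 < a" and b: "0 < b" and c: "0 < c"
    and "\<exists>C\<ge>0. \<forall>t z. energy UNIV z \<le> ennreal C * energy UNIV (wsum a b c t z)"
  shows "gabor_frame (indicator {0..<c}) a b"
  unfolding gabor_frame_iff[OF a b c]
proof -
  obtain C where C: "0 \<le> C" "\<And>t z. energy UNIV z \<le> ennreal C * energy UNIV (wsum a b c t z)"
    using assms(4) by blast
  show "\<exists>A>0. \<forall>f. square_integrable f \<longrightarrow>
      ennreal A * ennreal (l2_norm_sq f) \<le> (\<integral>\<^sup>+t. energy UNIV (wsum a b c t (fibre b f t)) \<partial>period b)"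
  proof (intro exI[of _ "1 / (C + 1)"] conjI allI impI)
    fix f assume f: "square_integrable f"
    have [measurable]: "f \<in> borel_measurable borel" using f by (auto simp: square_integrable_def)
    let ?T = "\<integral>\<^sup>+t. energy UNIV (wsum a b c t (fibre b f t)) \<partial>period b"
    have "ennreal (l2_norm_sq f) \<le> (\<integral>\<^sup>+t. ennreal (C + 1) * energy UNIV (wsum a b c t (fibre b f t)) \<partial>period b)"
      unfolding energy_fibre[OF f b, symmetric]
    proof (rule nn_integral_mono)
      fix t
      have "energy UNIV (fibre b f t) \<le> ennreal C * energy UNIV (wsum a b c t (fibre b f t))" by (rule C)
      also have "\<dots> \<le> ennreal (C + 1) * energy UNIV (wsum a b c t (fibre b f t))"
        by (intro mult_right_mono ennreal_leI) auto
      finally show "energy UNIV (fibre b f t) \<le> ennreal (C + 1) * energy UNIV (wsum a b c t (fibre b f t))" .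
    qed
    also have "\<dots> = ennreal (C + 1) * ?T"
    proof (rule nn_integral_cmult)
      have [measurable]: "(\<lambda>t. wsum a b c t (fibre b f t) m) \<in> borel_measurable (period b)" for m
        by (rule measurable_wsum_fibre[OF _ b]) measurable
      show "(\<lambda>t. energy UNIV (wsum a b c t (fibre b f t))) \<in> borel_measurable (period b)"
        by (intro borel_measurable_energy) measurable
    qed
    finally have "ennreal (1 / (C + 1)) * ennreal (l2_norm_sq f) \<le> ennreal (1 / (C + 1)) * (ennreal (C + 1) * ?T)"
      by (rule mult_left_mono) simp
    also have "\<dots> = ?T"
      using C(1) by (simp add: mult.assoc[symmetric] ennreal_mult''[symmetric] del: ennreal_plus)
    finally show "ennreal (1 / (C + 1)) * ennreal (l2_norm_sq f) \<le> ?T" .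
  qed (use C in simp)
qed

section \<open>Periodic orbits\<close>

lemma window_convex:
  assumes "k \<in> window a b c t m" "k' \<in> window a b c t m" "k \<le> j" "j \<le> k'" "0 < b"
  shows "j \<in> window a b c t m"
proof -
  have "of_int k * b \<le> of_int j * b" "of_int j * b \<le> of_int k' * b"
    using assms by (auto intro!: mult_right_mono)
  then show ?thesis using assms(1,2) by (auto simp: window_def)
qed

text \<open>Truncating a null vector changes window sums only near the two cuts. Boundedly many
  windows are affected, each by a bounded amount, so the bound does not depend on
  \<open>N\<close>.\<close>

lemma energy_wsum_truncation:
  assumes a: "0 < a" and b: "0 < b" and N: "0 \<le> N"
    and y: "\<And>k. norm (y k) \<le> 1" and W: "\<And>m. wsum a b c t y m = 0"
  shows "energy UNIV (wsum a b c t (\<lambda>k. if \<bar>k\<bar> \<le> N then y k else 0)) \<le>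
    ennreal (2 * real (nat (\<lceil>c / a\<rceil> + 1)) * (real (nat (\<lceil>c / b\<rceil> + 1)))\<^sup>2)"
proof -
  let ?z = "\<lambda>k. if \<bar>k\<bar> \<le> N then y k else 0"
  let ?B = "nat (\<lceil>c / b\<rceil> + 1)" and ?A = "nat (\<lceil>c / a\<rceil> + 1)"
  define S where "S = {m. N \<in> window a b c t m} \<union> {m. - N \<in> window a b c t m}"
  have finS: "finite S" using window_converse_bounds(1)[OF a] by (simp add: S_def)
  have "card S \<le> card {m. N \<in> window a b c t m} + card {m. - N \<in> window a b c t m}"
    unfolding S_def by (rule card_Un_le)
  also have "\<dots> \<le> ?A + ?A" by (intro add_mono window_converse_bounds(2)[OF a])
  finally have cardS: "real (card S) \<le> 2 * real ?A" by simp
  have zero: "wsum a b c t ?z m = 0" if m: "m \<notin> S" for m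
  proof -
    \<comment> \<open>A window with indices on both sides of a cut contains \<open>N\<close> or
      \<open>- N\<close> by convexity, so its number belongs to \<open>S\<close>.\<close>
    have "(\<forall>k\<in>window a b c t m. \<bar>k\<bar> \<le> N) \<or> (\<forall>k\<in>window a b c t m. \<not> \<bar>k\<bar> \<le> N)"
    proof (rule ccontr)
      assume "\<not> ?thesis"
      then obtain k k' where k: "k \<in> window a b c t m" "\<bar>k\<bar> \<le> N" and k': "k' \<in> window a b c t m" "N < \<bar>k'\<bar>"
        by force
      show False
      proof (cases "0 \<le> k'")
        case True
        then have "N \<in> window a b c t m" using k k' by (intro window_convex[OF k(1) k'(1) _ _ b]) auto
        then show False using m by (simp add: S_def)
      next
        case False
        then have "- N \<in> window a b c t m" using k k' by (intro window_convex[OF k'(1) k(1) _ _ b]) auto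
        then show False using m by (simp add: S_def)
      qed
    qed
    then show ?thesis
    proof
      assume "\<forall>k\<in>window a b c t m. \<bar>k\<bar> \<le> N"
      then have "wsum a b c t ?z m = wsum a b c t y m"
        unfolding wsum_def by (intro sum.cong) auto
      then show ?thesis using W by simp
    next
      assume "\<forall>k\<in>window a b c t m. \<not> \<bar>k\<bar> \<le> N"
      then show ?thesis unfolding wsum_def by (intro sum.neutral) auto
    qed
  qed
  have bound: "norm (wsum a b c t ?z m) \<le> real ?B" for m
  proof -
    have "norm (wsum a b c t ?z m) \<le> (\<Sum>k\<in>window a b c t m. 1)"
      unfolding wsum_def by (rule sum_norm_le) (use y in auto)
    also have "\<dots> \<le> real ?B" using window_bounds(2)[OF b, of a c t m] by simp
    finally show ?thesis .
  qed
  have "energy UNIV (wsum a b c t ?z) = (\<Sum>m\<in>S. ennreal ((norm (wsum a b c t ?z m))\<^sup>2))"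
    unfolding energy_def by (subst nn_integral_count_space'[OF finS]) (use zero in auto)
  also have "\<dots> \<le> (\<Sum>m\<in>S. ennreal ((real ?B)\<^sup>2))"
    by (intro sum_mono ennreal_leI power_mono bound) auto
  also have "\<dots> = ennreal (real (card S) * (real ?B)\<^sup>2)"
    by (subst sum_ennreal) auto
  also have "\<dots> \<le> ennreal (2 * real ?A * (real ?B)\<^sup>2)"
    using cardS by (intro ennreal_leI mult_right_mono) auto
  finally show ?thesis .
qed

text \<open>A bounded periodic null vector of the window sums, truncated, is an approximate null vector;
  spreading it over a small interval of base points gives a function violating the lower bound.\<close>

lemma not_gabor_frame_of_null_vector:
  assumes a: "0 < a" and b: "0 < b" and c: "0 < c" and P: "0 < P"
    and I: "0 \<le> s" "s < s'" "s' \<le> b"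
    and y: "\<And>k. norm (y k) \<le> 1" "\<And>k. y (k + P) = y k" "y k0 \<noteq> 0"
    and W: "\<And>t m. s \<le> t \<Longrightarrow> t < s' \<Longrightarrow> wsum a b c t y m = 0"
  shows "\<not> gabor_frame (indicator {0..<c}) a b"
proof
  assume "gabor_frame (indicator {0..<c}) a b"
  then obtain A where A: "0 < A" and lower: "\<And>f. square_integrable f \<Longrightarrow>
      ennreal A * ennreal (l2_norm_sq f) \<le> (\<integral>\<^sup>+t. energy UNIV (wsum a b c t (fibre b f t)) \<partial>period b)"
    unfolding gabor_frame_iff[OF a b c] by blast
  define D where "D = 2 * real (nat (\<lceil>c / a\<rceil> + 1)) * (real (nat (\<lceil>c / b\<rceil> + 1)))\<^sup>2"
  define \<delta> where "\<delta> = (norm (y k0))\<^sup>2"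
  have \<delta>: "0 < \<delta>" using y(3) by (simp add: \<delta>_def)
  have D0: "0 \<le> D" by (simp add: D_def)
  have "A * (real n * \<delta>) \<le> D" for n :: nat
  proof -
    \<comment> \<open>Large enough for the truncation to keep the \<open>n\<close> translates of
      \<open>k0\<close> by multiples of \<open>P\<close>, all with the same nonzero value.\<close>
    define N where "N = \<bar>k0\<bar> + int n * P"
    have N: "0 \<le> N" using P by (simp add: N_def)
    define z where "z = (\<lambda>k. if \<bar>k\<bar> \<le> N then y k else 0)"
    \<comment> \<open>The function whose fibre is \<open>z\<close> over base points in [s, s') and
      zero over all others.\<close>
    define f where "f = (\<lambda>x. z \<lfloor>x / b\<rfloor> * indicator {s..<s'} (x - of_int \<lfloor>x / b\<rfloor> * b))"
    have fl: "\<lfloor>(t + of_int k * b) / b\<rfloor> = k" if "t \<in> {0..<b}" for t k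
      using that b by (intro floor_unique) (auto simp: field_simps)
    have fib: "fibre b f t = (if t \<in> {s..<s'} then z else (\<lambda>_. 0))" if t: "t \<in> {0..<b}" for t
      unfolding fibre_def f_def fl[OF t] by (auto simp: fun_eq_iff indicator_def)
    have [measurable]: "(\<lambda>x. z \<lfloor>x / b\<rfloor>) \<in> borel_measurable borel"
      by (rule measurable_compose[of "\<lambda>x. \<lfloor>x / b\<rfloor>" _ "count_space UNIV"]) simp_all
    have [measurable]: "f \<in> borel_measurable borel" unfolding f_def by measurable
    have f: "square_integrable f"
      unfolding square_integrable_def
    proof
      show "f \<in> borel_measurable lborel" by simp
      show "integrable lborel (\<lambda>t. (norm (f t))\<^sup>2)"
      proof (rule Bochner_Integration.integrable_bound)
        show "integrable lborel (indicator {- of_int N * b..(of_int N + 1) * b} :: real \<Rightarrow> real)"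
          using N b by (intro integrable_real_indicator) (auto simp: emeasure_lborel_Icc_eq)
        show "AE x in lborel. norm ((norm (f x))\<^sup>2) \<le> norm (indicator {- of_int N * b..(of_int N + 1) * b} x :: real)"
        proof (rule AE_I2)
          fix x
          show "norm ((norm (f x))\<^sup>2) \<le> norm (indicator {- of_int N * b..(of_int N + 1) * b} x :: real)"
          proof (cases "\<bar>\<lfloor>x / b\<rfloor>\<bar> \<le> N")
            case True
            then have "- of_int N \<le> x / b" "x / b \<le> of_int N + 1" by linarith+
            then have "x \<in> {- of_int N * b..(of_int N + 1) * b}"
              using b by (auto simp: pos_le_divide_eq pos_divide_le_eq)
            moreover have "norm (f x) \<le> 1"
              using y(1) by (auto simp: f_def z_def norm_mult indicator_def)
            ultimately show ?thesis by (simp add: power_le_one)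
          qed (simp add: f_def z_def)
        qed
      qed measurable
    qed
    have emI: "(\<integral>\<^sup>+t. indicator {s..<s'} t \<partial>period b) = ennreal (s' - s)"
    proof -
      have "(\<integral>\<^sup>+t. indicator {s..<s'} t \<partial>period b) = emeasure (period b) {s..<s'}"
        using I by (intro nn_integral_indicator) (auto simp: sets_restrict_space_iff)
      also have "\<dots> = ennreal (s' - s)"
        using I by (subst emeasure_restrict_space) auto
      finally show ?thesis .
    qed
    have "ennreal (l2_norm_sq f) = (\<integral>\<^sup>+t. energy UNIV (fibre b f t) \<partial>period b)"
      by (rule energy_fibre[OF f b, symmetric])
    also have "\<dots> = (\<integral>\<^sup>+t. energy UNIV z * indicator {s..<s'} t \<partial>period b)"
      by (rule nn_integral_cong) (simp add: fib energy_def)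
    also have "\<dots> = energy UNIV z * ennreal (s' - s)"
    proof (subst nn_integral_cmult)
      show "indicator {s..<s'} \<in> borel_measurable (period b)" by (rule measurable_period) measurable
    qed (simp add: emI)
    finally have norm_f: "ennreal (l2_norm_sq f) = energy UNIV z * ennreal (s' - s)" .
    have "(\<integral>\<^sup>+t. energy UNIV (wsum a b c t (fibre b f t)) \<partial>period b) \<le> (\<integral>\<^sup>+t. ennreal D * indicator {s..<s'} t \<partial>period b)"
    proof (rule nn_integral_mono)
      fix t assume "t \<in> space (period b)"
      then have t: "t \<in> {0..<b}" by simp
      show "energy UNIV (wsum a b c t (fibre b f t)) \<le> ennreal D * indicator {s..<s'} t"
      proof (cases "t \<in> {s..<s'}")
        case True
        then have "energy UNIV (wsum a b c t z) \<le> ennreal D"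
          unfolding z_def D_def by (intro energy_wsum_truncation a b N y(1) W) auto
        then show ?thesis using True t by (simp add: fib)
      next
        case False
        then show ?thesis by (simp only: fib[OF t] if_False) (simp add: wsum_def energy_def)
      qed
    qed
    also have "\<dots> = ennreal D * ennreal (s' - s)"
    proof (subst nn_integral_cmult)
      show "indicator {s..<s'} \<in> borel_measurable (period b)" by (rule measurable_period) measurable
    qed (simp add: emI)
    finally have up: "(\<integral>\<^sup>+t. energy UNIV (wsum a b c t (fibre b f t)) \<partial>period b) \<le> ennreal (D * (s' - s))"
      using D0 by (simp add: ennreal_mult')
    have yP: "y (k0 + int j * P) = y k0" for j :: nat
    proof (induction j)
      case (Suc j)
      have "k0 + int (Suc j) * P = (k0 + int j * P) + P" by (simp add: algebra_simps)
      then show ?case using y(2) Suc by presburger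
    qed simp
    have "ennreal (real n * \<delta>) \<le> (\<Sum>k\<in>(\<lambda>j. k0 + int j * P) ` {..<n}. ennreal ((norm (z k))\<^sup>2))"
    proof -
      have inj: "inj_on (\<lambda>j. k0 + int j * P) {..<n}" using P by (auto simp: inj_on_def)
      have "ennreal ((norm (z (k0 + int j * P)))\<^sup>2) = ennreal \<delta>" if "j \<in> {..<n}" for j
      proof -
        have "int j * P \<le> int n * P" "0 \<le> int j * P" using that P by (auto intro: mult_right_mono)
        then have "\<bar>k0 + int j * P\<bar> \<le> N" by (simp add: N_def)
        then show ?thesis by (simp add: z_def yP \<delta>_def)
      qed
      then have "(\<Sum>k\<in>(\<lambda>j. k0 + int j * P) ` {..<n}. ennreal ((norm (z k))\<^sup>2)) = (\<Sum>j<n. ennreal \<delta>)"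
        unfolding sum.reindex[OF inj] by (intro sum.cong) auto
      also have "\<dots> = ennreal (real n * \<delta>)" using \<delta> by (subst sum_ennreal) auto
      finally show ?thesis by simp
    qed
    also have "\<dots> \<le> energy UNIV z"
      using sum_le_nn_integral_count_space[of "(\<lambda>j. k0 + int j * P) ` {..<n}" "\<lambda>k. ennreal ((norm (z k))\<^sup>2)"]
      by (simp add: energy_def)
    finally have "ennreal A * (ennreal (real n * \<delta>) * ennreal (s' - s)) \<le> ennreal A * ennreal (l2_norm_sq f)"
      unfolding norm_f by (intro mult_left_mono mult_right_mono) auto
    also have "\<dots> \<le> ennreal (D * (s' - s))" using lower[OF f] up by (rule order_trans)
    finally have "ennreal (A * (real n * \<delta>) * (s' - s)) \<le> ennreal (D * (s' - s))"
      using A \<delta> I by (simp add: ennreal_mult'[symmetric] mult.assoc)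
    then have "A * (real n * \<delta>) * (s' - s) \<le> D * (s' - s)"
      using D0 I by (simp add: ennreal_le_iff)
    then show ?thesis using I by simp
  qed
  \<comment> \<open>The energy grows linearly with \<open>n\<close>, while the window sums stay
    below the fixed bound \<open>D\<close>.\<close>
  moreover obtain n :: nat where "D < real n * (A * \<delta>)"
    using reals_Archimedean3[of "A * \<delta>"] A \<delta> by auto
  ultimately show False by (metis mult.left_commute not_less)
qed

text \<open>The residue \<open>r\<close> modulo \<open>a\<close> of a point lies in a cycle of length \<open>M\<close>: the point belongs to
  exactly \<open>M\<close> consecutive windows.\<close>

definition cyclic_residue :: "real \<Rightarrow> real \<Rightarrow> int \<Rightarrow> real \<Rightarrow> bool" where
  "cyclic_residue a c M r \<longleftrightarrow> (\<forall>u::int. 0 \<le> of_int u * a + r \<and> of_int u * a + r < c \<longleftrightarrow> 0 \<le> u \<and> u < M)"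

text \<open>Advancing by \<open>P\<close> indices advances the cell number by \<open>M\<close> at
  the same residue. Each orbit point lies in exactly \<open>M\<close> consecutive windows, so the
  orbit as a whole meets every window exactly once.\<close>

lemma sum_window_orbit:
  assumes b: "0 < b" and M: "0 < M" and PM: "of_int P * b = of_int M * a"
    and t: "t + of_int k1 * b = of_int n1 * a + r" and r: "cyclic_residue a c M r"
  shows "(\<Sum>k\<in>window a b c t m. if P dvd k - k1 then 1 else 0 :: complex) = 1"
proof -
  \<comment> \<open>The unique \<open>j\<close> for which \<open>n1 - m + j * M\<close> is the
    remainder of \<open>n1 - m\<close> modulo \<open>M\<close>.\<close>
  define j0 where "j0 = - ((n1 - m) div M)"
  have mem: "k1 + P * j \<in> window a b c t m \<longleftrightarrow> j = j0" for j
  proof -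
    have "t + of_int (k1 + P * j) * b - of_int m * a = (t + of_int k1 * b) + of_int j * (of_int P * b) - of_int m * a"
      by (simp add: algebra_simps)
    also have "\<dots> = of_int (n1 - m + j * M) * a + r"
      unfolding PM t by (simp add: algebra_simps)
    finally have eq: "t + of_int (k1 + P * j) * b - of_int m * a = of_int (n1 - m + j * M) * a + r" .
    have "k1 + P * j \<in> window a b c t m \<longleftrightarrow> 0 \<le> n1 - m + j * M \<and> n1 - m + j * M < M"
      unfolding window_def mem_Collect_eq eq using r unfolding cyclic_residue_def by blast
    also have "\<dots> \<longleftrightarrow> j = j0"
    proof
      assume *: "0 \<le> n1 - m + j * M \<and> n1 - m + j * M < M"
      have "(n1 - m + j * M) div M = 0" using * by (intro div_pos_pos_trivial) auto
      moreover have "(n1 - m + j * M) div M = (n1 - m) div M + j" using M by simp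
      ultimately show "j = j0" by (simp add: j0_def)
    next
      assume "j = j0"
      then have "n1 - m + j * M = (n1 - m) mod M"
        by (simp add: j0_def minus_div_mult_eq_mod)
      then show "0 \<le> n1 - m + j * M \<and> n1 - m + j * M < M" using M by simp
    qed
    finally show ?thesis .
  qed
  have "{k \<in> window a b c t m. P dvd k - k1} = {k1 + P * j0}"
  proof
    show "{k \<in> window a b c t m. P dvd k - k1} \<subseteq> {k1 + P * j0}"
    proof
      fix k assume k: "k \<in> {k \<in> window a b c t m. P dvd k - k1}"
      then obtain j where "k - k1 = P * j" by (auto elim: dvdE)
      then have "k = k1 + P * j" by simp
      then show "k \<in> {k1 + P * j0}" using k mem by simp
    qed
    show "{k1 + P * j0} \<subseteq> {k \<in> window a b c t m. P dvd k - k1}" using mem[of j0] by simp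
  qed
  moreover have "(\<Sum>k\<in>window a b c t m. if P dvd k - k1 then 1 else 0 :: complex)
      = (\<Sum>k\<in>{k \<in> window a b c t m. P dvd k - k1}. 1)"
    by (rule sum.inter_filter[symmetric]) (rule window_bounds(1)[OF b])
  ultimately show ?thesis by simp
qed

text \<open>The vector is 1 on the orbit of 0 and -1 on the orbit of \<open>k2\<close>; these are
  disjoint as \<open>P\<close> does not divide \<open>k2\<close>. For base points in [\<alpha>,
  \<beta> - e) both residues \<open>t\<close> and \<open>t + e\<close> are cyclic, so every window
  sum is 1 - 1.\<close>

lemma not_gabor_frame_two_orbits:
  assumes a: "0 < a" and ab: "a < b" and c: "0 < c" and M: "0 < M" and P: "0 < P"
    and PM: "of_int P * b = of_int M * a"
    and \<alpha>: "0 \<le> \<alpha>" "\<beta> \<le> a"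
    and cyc: "\<And>r. \<alpha> \<le> r \<Longrightarrow> r < \<beta> \<Longrightarrow> cyclic_residue a c M r"
    and k2: "of_int k2 * b = e + of_int u * a" "0 \<le> e" "e < \<beta> - \<alpha>" "\<not> P dvd k2"
  shows "\<not> gabor_frame (indicator {0..<c}) a b"
proof -
  define y :: "int \<Rightarrow> complex" where "y = (\<lambda>k. (if P dvd k - 0 then 1 else 0) - (if P dvd k - k2 then 1 else 0))"
  have b: "0 < b" using a ab by linarith
  have sh: "P dvd k + P - k2 \<longleftrightarrow> P dvd k - k2" for k
    by (metis add_diff_eq diff_add_eq dvd_add_triv_right_iff)
  show ?thesis
  proof (rule not_gabor_frame_of_null_vector[OF a b c P, where s = \<alpha> and s' = "\<beta> - e" and y = y and ?k0.0 = 0])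
    show "wsum a b c t y m = 0" if t: "\<alpha> \<le> t" "t < \<beta> - e" for t m
    proof -
      have "(\<Sum>k\<in>window a b c t m. if P dvd k - 0 then 1 else 0 :: complex) = 1"
        by (rule sum_window_orbit[OF b M PM, where r = t and ?n1.0 = 0]) (use t k2 cyc in auto)
      moreover have "(\<Sum>k\<in>window a b c t m. if P dvd k - k2 then 1 else 0 :: complex) = 1"
        by (rule sum_window_orbit[OF b M PM, where r = "t + e" and ?n1.0 = u]) (use t k2 cyc in auto)
      ultimately show ?thesis unfolding wsum_def y_def sum_subtractf by simp
    qed
  qed (use \<alpha> k2 ab sh in \<open>auto simp: y_def\<close>)
qed

text \<open>Two possible sources of a second orbit are excluded: a common factor of \<open>P\<close>
  and \<open>M\<close>, and a cyclic interval longer than the spacing \<open>b / q\<close> of the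
  attainable residues.\<close>

lemma gabor_frame_rational_condition:
  assumes a: "0 < a" and ab: "a < b" and c: "0 < c" and M: "0 < M" and P: "2 \<le> P"
    and PM: "of_int P * b = of_int M * a"
    and \<alpha>: "0 \<le> \<alpha>" "\<alpha> < \<beta>" "\<beta> \<le> a"
    and cyc: "\<And>r. \<alpha> \<le> r \<Longrightarrow> r < \<beta> \<Longrightarrow> cyclic_residue a c M r"
    and fr: "gabor_frame (indicator {0..<c}) a b"
  shows "\<exists>p q :: nat. 0 < p \<and> 0 < q \<and> coprime p q \<and> a / b = real p / real q
              \<and> \<beta> - \<alpha> \<le> b / real q \<and> P = int p"
proof -
  have b: "0 < b" using a ab by linarith
  define g where "g = gcd P M"
  have g: "0 < g" using P by (simp add: g_def)
  obtain p q where pq: "P = p * g" "M = q * g" "coprime p q"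
    using gcd_coprime_exists[of P M] g unfolding g_def by (metis less_irrefl)
  have "0 < p * g" "0 < q * g" using P M pq(1,2) by auto
  then have p0: "0 < p" "0 < q" using g by (auto simp: zero_less_mult_iff)
  have pqab: "of_int p * b = of_int q * a"
  proof -
    have "of_int g * (of_int p * b) = of_int g * (of_int q * a)"
      using PM unfolding pq(1,2) of_int_mult by (simp only: mult_ac)
    then show ?thesis using g by simp
  qed
  note no = not_gabor_frame_two_orbits[OF a ab c M _ PM \<alpha>(1,3) cyc]
  have g1: "g = 1"
  proof (rule ccontr)
    assume "g \<noteq> 1"
    then have g2: "2 \<le> g" using g by simp
    have "p < P" using p0 g2 unfolding pq(1) by (simp add: mult_less_cancel_left1)
    then have "\<not> P dvd p" using p0 zdvd_not_zless by blast
    \<comment> \<open>With a common factor, stepping by \<open>p\<close> instead of \<open>P\<close>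
      returns to the same residue, a second orbit with displacement 0.\<close>
    then show False using no[of p 0 q] fr pqab P \<alpha> by auto
  qed
  then have Pp: "P = p" and p2: "2 \<le> p" using pq P by auto
  have le: "\<beta> - \<alpha> \<le> b / of_int q"
  proof (rule ccontr)
    assume neg: "\<not> \<beta> - \<alpha> \<le> b / of_int q"
    \<comment> \<open>Bezout provides an index step \<open>k\<close> that shifts residues by the
      smallest positive amount \<open>b / q\<close>.\<close>
    obtain k v where kv: "k * q + v * p = 1"
      using bezout_int[of q p] pq(3) by (metis coprime_commute coprime_imp_gcd_eq_1)
    have "of_int k * b = b / of_int q + of_int (- v) * a"
    proof -
      have a_eq: "a = of_int p * b / of_int q" using pqab p0 by (simp add: field_simps)
      have "of_int k * b - of_int (- v) * a = b * (of_int k * of_int q + of_int v * of_int p) / of_int q"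
        using p0 by (simp add: a_eq field_simps)
      also have "of_int k * of_int q + of_int v * of_int p = (1 :: real)"
        using kv by (metis of_int_1 of_int_add of_int_mult)
      finally show ?thesis by simp
    qed
    moreover have "\<not> P dvd k"
    proof
      assume "P dvd k"
      \<comment> \<open>Otherwise \<open>p\<close> would divide 1; this is where
        \<open>2 \<le> P\<close> enters.\<close>
      then have "p dvd k * q + v * p" unfolding Pp by simp
      then show False using kv p2 by (simp add: zdvd1_eq)
    qed
    ultimately show False using no[of k "b / of_int q" "- v"] fr P neg b p0 by auto
  qed
  show ?thesis
  proof (rule exI[of _ "nat p"], rule exI[of _ "nat q"], intro conjI)
    show "coprime (nat p) (nat q)" using pq(3) p0 by (simp add: coprime_int_iff[symmetric])
    show "a / b = real (nat p) / real (nat q)"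
      using pqab p0 b by (simp add: field_simps)
  qed (use p0 le Pp in auto)
qed

section \<open>The two boundary cases\<close>

context abc_params
begin

text \<open>Residues differ by multiples of \<open>b / q\<close>, so two of them in a half-open
  interval of at most that length coincide. Then \<open>i * q\<close> is a multiple of
  \<open>p\<close>, and coprimality finishes.\<close>

lemma residue_dvd:
  assumes "residue t k \<in> {\<alpha>..<\<beta>}" "residue t (k + i) \<in> {\<alpha>..<\<beta>}"
    and q: "0 < q" and pq: "coprime p q" "a / b = real p / real q" "\<beta> - \<alpha> \<le> b / real q"
  shows "int p dvd i"
proof -
  have b0: "0 < b" using a0 ab by linarith
  define j where "j = cell t (k + i) - cell t k"
  define w where "w = i * int q - j * int p"
  have a_eq: "a = real p * b / real q" using pq(2) b0 q by (simp add: field_simps)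
  have "residue t (k + i) - residue t k = of_int i * b - of_int j * a"
    by (simp add: residue_def j_def algebra_simps)
  also have "\<dots> = of_int w * (b / real q)"
    using q by (simp add: a_eq w_def field_simps)
  finally have eq: "residue t (k + i) - residue t k = of_int w * (b / real q)" .
  have bq: "0 < b / real q" using b0 q by simp
  have "w = 0"
  proof (rule ccontr)
    assume "w \<noteq> 0"
    then have "1 * (b / real q) \<le> \<bar>of_int w\<bar> * (b / real q)"
      using bq by (intro mult_right_mono) auto
    also have "\<dots> = \<bar>residue t (k + i) - residue t k\<bar>" using b0 by (simp add: eq abs_mult)
    also have "\<dots> < \<beta> - \<alpha>" using assms(1,2) by auto
    finally show False using pq(3) by simp
  qed
  then have "int p dvd i * int q" by (simp add: w_def)
  then show ?thesis using pq(1) by (simp add: coprime_dvd_mult_left_iff)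
qed

lemma b_pos: "0 < b" using a0 ab by linarith

lemma c_pos: "0 < c" using c_eq int_mult_b(1)[OF d1] b_pos c0_lower ab by linarith

text \<open>Here \<open>c = M * a - (b - c0)\<close>: in the last of the \<open>M\<close> cells
  exactly the residues below \<open>h\<close> still precede \<open>c\<close>.\<close>

lemma cyclic_residue_left:
  assumes "of_int (d + 1) * b = of_int M * a" "0 \<le> r" "r < h"
  shows "cyclic_residue a c M r"
  unfolding cyclic_residue_def
proof (intro allI)
  fix u :: int
  have c: "c = of_int M * a - (b - c0)" using assms(1) c_eq by (simp add: algebra_simps)
  have *: "of_int u * a + r < c \<longleftrightarrow> u < M"
  proof
    assume "of_int u * a + r < c"
    then have "of_int u * a < of_int M * a" using c assms c0_upper ab by linarith
    then show "u < M" using a0 by (simp add: mult_less_cancel_right)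
  next
    assume "u < M"
    then have "of_int (u + 1) * a \<le> of_int M * a" using a0 by (intro mult_right_mono) auto
    then show "of_int u * a + r < c" using c assms by (simp add: algebra_simps)
  qed
  have "0 \<le> of_int u * a + r \<longleftrightarrow> 0 \<le> u"
  proof
    assume "0 \<le> of_int u * a + r"
    then have "0 < of_int (u + 1) * a" using assms ab c0_upper by (simp add: algebra_simps)
    then show "0 \<le> u" using a0 by (simp add: zero_less_mult_iff)
  qed (use a0 assms in simp)
  then show "0 \<le> of_int u * a + r \<and> of_int u * a + r < c \<longleftrightarrow> 0 \<le> u \<and> u < M" using * by simp
qed

text \<open>Here \<open>c = M * a + c0\<close>: residues from \<open>c0\<close> on just miss a
  further cell.\<close>

lemma cyclic_residue_right:
  assumes "of_int d * b = of_int M * a" "c0 \<le> r" "r < a"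
  shows "cyclic_residue a c M r"
  unfolding cyclic_residue_def
proof (intro allI)
  fix u :: int
  have c: "c = of_int M * a + c0" using assms(1) c_eq by simp
  have *: "of_int u * a + r < c \<longleftrightarrow> u < M"
  proof
    assume "of_int u * a + r < c"
    then have "of_int u * a < of_int M * a" using c assms by linarith
    then show "u < M" using a0 by (simp add: mult_less_cancel_right)
  next
    assume "u < M"
    then have "of_int (u + 1) * a \<le> of_int M * a" using a0 by (intro mult_right_mono) auto
    then show "of_int u * a + r < c" using c assms c0_lower ab by (simp add: algebra_simps)
  qed
  have "0 \<le> of_int u * a + r \<longleftrightarrow> 0 \<le> u"
  proof
    assume "0 \<le> of_int u * a + r"
    then have "0 < of_int (u + 1) * a" using assms by (simp add: algebra_simps)
    then show "0 \<le> u" using a0 by (simp add: zero_less_mult_iff)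
  qed (use a0 assms c0_lower ab in simp)
  then show "0 \<le> of_int u * a + r \<and> of_int u * a + r < c \<longleftrightarrow> 0 \<le> u \<and> u < M" using * by simp
qed

text \<open>Residues left of the hole are fixed by the step \<open>d + 1\<close>, those to the right
  drift into it. The first fact yields necessity; the second, with isolation of the fixed residues,
  yields sufficiency.\<close>

lemma frame_left_cycles_iff:
  assumes M: "of_int (d + 1) * b = of_int M * a"
  shows "gabor_frame (indicator {0..<c}) a b \<longleftrightarrow>
    (\<exists>p q :: nat. 0 < p \<and> 0 < q \<and> coprime p q \<and> a / b = real p / real q \<and> c0 \<le> b - a + b / real q \<and> d + 1 = int p)"
    (is "_ \<longleftrightarrow> ?R")
proof
  have "0 < of_int M * a" using M b_pos d1 by (metis mult_pos_pos of_int_pos zle_add1_eq_le zless_add1_eq zero_less_one order_less_le_trans)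
  then have M0: "0 < M" using a0 by (simp add: zero_less_mult_iff)
  assume "gabor_frame (indicator {0..<c}) a b"
  \<comment> \<open>The cyclic interval is [0, h), whose length \<open>h \<le> b / q\<close> is the
    stated bound on \<open>c0\<close>.\<close>
  from gabor_frame_rational_condition[OF a0 ab c_pos M0 _ M _ _ _ cyclic_residue_left[OF M] this, of 0 h]
  show ?R using d1 c0_lower c0_upper ab by (auto simp: algebra_simps)
next
  assume ?R
  then obtain p q where pq: "0 < p" "0 < q" "coprime p q" "a / b = real p / real q" "c0 \<le> b - a + b / real q" "d + 1 = int p"
    by blast
  \<comment> \<open>The step \<open>d\<close> moves residues left by the full length of the hole,
    the extreme case allowed by \<open>energy_right_bound\<close>.\<close>
  have "of_int d * b = - (b - a) + of_int (M - 1) * a" using M by (simp add: algebra_simps)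
  then obtain C where C: "0 \<le> C" "\<And>t z. energy {k. h \<le> residue t k} z \<le> ennreal C * energy UNIV (wsum a b c t z)"
    using energy_right_bound[of "b - a" "M - 1"] ab by auto
  show "gabor_frame (indicator {0..<c}) a b"
  proof (rule gabor_frame_of_stable[OF a0 b_pos c_pos], rule stable_isolated[OF C(1)])
    show "energy {k. residue t k \<notin> {0..<h}} z \<le> ennreal C * energy UNIV (wsum a b c t z)" for t z
    proof -
      have "{k. residue t k \<notin> {0..<h}} = {k. h \<le> residue t k}" using residue_bounds(1)[of t] by auto
      then show ?thesis using C(2)[of t z] by simp
    qed
    fix t k i
    assume i: "1 \<le> i" "i \<le> d" "residue t k \<in> {0..<h}" "residue t (k + i) \<in> {0..<h}"
    have "int p dvd i" by (rule residue_dvd[OF i(3,4) pq(2,3,4)]) (use pq(5) in simp)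
    \<comment> \<open>Offsets inside a window are at most \<open>d\<close>, which is less than
      \<open>p = d + 1\<close>.\<close>
    then show False using i pq(6) zdvd_imp_le[of "int p" i] by simp
  qed
qed

text \<open>The mirror case: residues from \<open>c0\<close> on are fixed by the step
  \<open>d\<close>, and those to the left drift rightwards by \<open>b - a\<close>.\<close>

lemma frame_right_cycles_iff:
  assumes M: "of_int d * b = of_int M * a" and d2: "2 \<le> d"
  shows "gabor_frame (indicator {0..<c}) a b \<longleftrightarrow>
    (\<exists>p q :: nat. 0 < p \<and> 0 < q \<and> coprime p q \<and> a / b = real p / real q \<and> c0 \<ge> a - b / real q \<and> d = int p)"
    (is "_ \<longleftrightarrow> ?R")
proof
  have "0 < of_int M * a" using M b_pos d1 by (metis mult_pos_pos of_int_pos zero_less_one order_less_le_trans)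
  then have M0: "0 < M" using a0 by (simp add: zero_less_mult_iff)
  assume "gabor_frame (indicator {0..<c}) a b"
  from gabor_frame_rational_condition[OF a0 ab c_pos M0 d2 M _ _ _ cyclic_residue_right[OF M] this, of c0 a]
  show ?R using c0_lower c0_upper ab by (auto simp: algebra_simps)
next
  assume ?R
  then obtain p q where pq: "0 < p" "0 < q" "coprime p q" "a / b = real p / real q" "c0 \<ge> a - b / real q" "d = int p"
    by blast
  have "of_int (d + 1) * b = (b - a) + of_int (M + 1) * a" using M by (simp add: algebra_simps)
  then obtain C where C: "0 \<le> C" "\<And>t z. energy {k. residue t k < c0} z \<le> ennreal C * energy UNIV (wsum a b c t z)"
    using energy_left_bound[of "b - a" "M + 1"] ab by auto
  show "gabor_frame (indicator {0..<c}) a b"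
  proof (rule gabor_frame_of_stable[OF a0 b_pos c_pos], rule stable_isolated[OF C(1)])
    show "energy {k. residue t k \<notin> {c0..<a}} z \<le> ennreal C * energy UNIV (wsum a b c t z)" for t z
    proof -
      have "{k. residue t k \<notin> {c0..<a}} = {k. residue t k < c0}" using residue_bounds(2)[of t] by auto
      then show ?thesis using C(2)[of t z] by simp
    qed
    fix t k i
    assume i: "1 \<le> i" "i \<le> d" "residue t k \<in> {c0..<a}" "residue t (k + i) \<in> {c0..<a}"
      "residue t k + of_int i * b < c"
    have "int p dvd i" by (rule residue_dvd[OF i(3,4) pq(2,3,4)]) (use pq(5) in simp)
    \<comment> \<open>Now \<open>p = d\<close>, so divisibility leaves the offset \<open>d\<close>
      open; but a residue of at least \<open>c0\<close> is carried by it to \<open>c\<close> or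
      beyond, out of the window.\<close>
    then have "i = d" using i pq(6) zdvd_imp_le[of "int p" i] by simp
    then show False using i c_eq by simp
  qed
qed

end

theorem theorem2p3:
  fixes a b c :: real
  defines "c0 \<equiv> c - of_int \<lfloor>c / b\<rfloor> * b"
  defines "c1 \<equiv> of_int \<lfloor>c / b\<rfloor> * b - of_int \<lfloor>of_int \<lfloor>c / b\<rfloor> * b / a\<rfloor> * a"
  assumes "0 < a" "a < b" "b < c"
    and "b - a < c0" "c0 < a"
    and "\<lfloor>c / b\<rfloor> \<ge> 2"
  shows "(c1 > 2 * a - b \<longrightarrow> gabor_frame (indicator {0..<c}) a b)
    \<and> (c1 = 2 * a - b \<longrightarrow>
         (gabor_frame (indicator {0..<c}) a b \<longleftrightarrow>
           (\<exists>p q :: nat. 0 < p \<and> 0 < q \<and> coprime p q \<and> a / b = real p / real q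
              \<and> c0 \<le> b - a + b / real q \<and> \<lfloor>c / b\<rfloor> + 1 = int p)))
    \<and> (c1 = 0 \<longrightarrow>
         (gabor_frame (indicator {0..<c}) a b \<longleftrightarrow>
           (\<exists>p q :: nat. 0 < p \<and> 0 < q \<and> coprime p q \<and> a / b = real p / real q
              \<and> c0 \<ge> a - b / real q \<and> \<lfloor>c / b\<rfloor> = int p)))"
proof -
  define d where "d = \<lfloor>c / b\<rfloor>"
  define v where "v = \<lfloor>of_int d * b / a\<rfloor>"
  have d2: "2 \<le> d" using assms by (simp add: d_def)
  interpret abc_params a b c d c0
    by unfold_locales (use assms in \<open>auto simp: d_def c0_def\<close>)
  \<comment> \<open>So \<open>c1\<close> is \<open>d * b\<close> reduced modulo \<open>a\<close>;
    its value decides how the steps \<open>d\<close> and \<open>d + 1\<close> act on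
    residues.\<close>
  have c1: "of_int d * b = c1 + of_int v * a"
    by (simp add: c1_def d_def v_def)
  have "of_int d * b / a < of_int v + 1" unfolding v_def by linarith
  then have c1_less: "c1 < a" using c1 a0 by (simp add: pos_divide_less_eq algebra_simps)
  \<comment> \<open>The step \<open>d + 1\<close> moves residues right by
    \<open>c1 + b - 2 * a\<close>, the step \<open>d\<close> moves them left by
    \<open>a - c1\<close>. Both amounts are positive here; the two equality cases below have
    \<open>M = v + 2\<close> and \<open>M = v\<close>.\<close>
  have "gabor_frame (indicator {0..<c}) a b" if "c1 > 2 * a - b"
    by (rule gabor_frame_of_stable[OF a0 b_pos c_pos],
        rule stable_left_right[of "c1 + b - 2 * a" "a - c1" "v + 2" "v + 1"])
      (use that c1 c1_less in \<open>auto simp: algebra_simps\<close>)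
  moreover have "gabor_frame (indicator {0..<c}) a b \<longleftrightarrow>
       (\<exists>p q :: nat. 0 < p \<and> 0 < q \<and> coprime p q \<and> a / b = real p / real q
          \<and> c0 \<le> b - a + b / real q \<and> d + 1 = int p)" if "c1 = 2 * a - b"
    by (rule frame_left_cycles_iff[of "v + 2"]) (use that c1 in \<open>simp add: algebra_simps\<close>)
  moreover have "gabor_frame (indicator {0..<c}) a b \<longleftrightarrow>
       (\<exists>p q :: nat. 0 < p \<and> 0 < q \<and> coprime p q \<and> a / b = real p / real q
          \<and> c0 \<ge> a - b / real q \<and> d = int p)" if "c1 = 0"
    by (rule frame_right_cycles_iff[of v]) (use that c1 d2 in simp_all)
  ultimately show ?thesis unfolding d_def by blast
qed

end
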